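(* Suppose that $W$ satisfies the second structural condition. Then for any $p\in(1,\infty)$ the operator $I_{\frac{p-1}{p}}$ maps $\mathfrak{W}$ to $L_{p,1}$ (boundedly): there is a constant $C$, independent of $F$, such that $\|I_{\frac{p-1}{p}}[F]\|_{L_{p,1}}\le C\|F\|_{L_1}$ for all $F\in\mathfrak{W}$.
   Context: Fix integers $m\ge 3$ and $\ell\ge 1$. Consider a probability space with an $m$-uniform filtration $\mathcal{F}=\{\mathcal{F}_n\}_{n\ge0}$: $\mathcal{F}_0$ is trivial, each $\mathcal{F}_n$ is a finite algebra with set of atoms $\mathcal{AF}_n$, and each atom in $\mathcal{F}_n$ is split into $m$ atoms of $\mathcal{F}_{n+1}$ (its children) of equal probability. All martingales are adapted to $\mathcal{F}$; for a martingale $F=\{F_n\}_{n\ge0}$ put $f_{n+1}=F_{n+1}-F_n$, $n\ge 0$. The norm $\|\cdot\|$ on $\mathbb{R}^\ell$ is Euclidean. Let $V=\{v\in\mathbb{R}^m : \sum_{j=1}^m v_j=0\}$. Elements of $V^\ell$ are identified with $m$-tuples $\{b_j\}_{j=1}^m$ of vectors $b_j\in\mathbb{R}^\ell$ with $\sum_j b_j=0$; for $v\in V$, $a\in\mathbb{R}^\ell$, $v\otimes a=\{v_j a\}_{j=1}^m$. For each $n$ and $\omega\in\mathcal{AF}_n$ fix a bijection $J_\omega$ from $\{1,\dots,m\}$ onto the set of children of $\omega$; for $b\in V^\ell$ let $J_\omega[b]$ be the function on $\omega$ equal to $b_j$ on the child $J_\omega(j)$. Let $W$ be a linear subspace of $V^\ell$.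 $L_1(\mathbb{R}^\ell)$ is the space of $\mathbb{R}^\ell$-valued martingales with $\|F\|_{L_1}=\sup_n\mathbb{E}\|F_n\|<\infty$, and $$\mathfrak{W}=\{F\in L_1(\mathbb{R}^\ell) : \forall n\ge0,\ \forall\omega\in\mathcal{AF}_n,\ f_{n+1}|_\omega\in J_\omega[W]\},$$ with the norm $\|F\|_{\mathfrak{W}}=\|F\|_{L_1}$. Second structural condition on $W$: $W$ contains no non-zero vector $v\otimes a$ with $a\in\mathbb{R}^\ell$ and $v\in V$ having $m-1$ equal coordinates. Riesz potential: $(I_\alpha[F])_N=\sum_{n=1}^N m^{-\alpha n}f_n$, i.e. $I_\alpha[F]=\sum_{n\ge1}m^{-\alpha n}f_n$. A martingale is said to belong to a function space such as the Lorentz space $L_{p,1}$ if it is the sequence of conditional expectations of a function $g$ in that space, and its norm is then the norm of $g$ (for vector-valued $g$, the norm of the scalar function $\|g\|$). *)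

theory Defs
  imports "HOL-Probability.Probability"
begin

section \<open>Uniform filtrations\<close>

definition alg_atoms :: "'a measure \<Rightarrow> 'a set set" where
  "alg_atoms N = {A \<in> sets N. A \<noteq> {} \<and> (\<forall>B\<in>sets N. B \<subseteq> A \<longrightarrow> B = {} \<or> B = A)}"

definition children :: "(nat \<Rightarrow> 'a measure) \<Rightarrow> nat \<Rightarrow> 'a set \<Rightarrow> 'a set set" where
  "children Fm n \<omega> = {\<omega>' \<in> alg_atoms (Fm (Suc n)). \<omega>' \<subseteq> \<omega>}"

text \<open>The algebras are given as measure spaces of which only the carrier and the measurable
  sets matter; probabilities are always taken with respect to \<open>M\<close>.\<close>

definition uniform_filtration :: "nat \<Rightarrow> 'a measure \<Rightarrow> (nat \<Rightarrow> 'a measure) \<Rightarrow> bool" where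
  "uniform_filtration m M Fm \<longleftrightarrow>
     filtration (space M) Fm \<and>
     (\<forall>n. subalgebra M (Fm n)) \<and>
     sets (Fm 0) = {{}, space M} \<and>
     (\<forall>n. finite (sets (Fm n))) \<and>
     (\<forall>n. \<forall>\<omega>\<in>alg_atoms (Fm n).
        card (children Fm n \<omega>) = m \<and>
        (\<forall>\<omega>1\<in>children Fm n \<omega>. \<forall>\<omega>2\<in>children Fm n \<omega>. measure M \<omega>1 = measure M \<omega>2))"

definition limit_algebra :: "'a measure \<Rightarrow> (nat \<Rightarrow> 'a measure) \<Rightarrow> 'a measure" where
  "limit_algebra M Fm = sigma (space M) (\<Union>n. sets (Fm n))"

definition child_enumeration ::
  "(nat \<Rightarrow> 'a measure) \<Rightarrow> (nat \<Rightarrow> 'a set \<Rightarrow> 'm::finite \<Rightarrow> 'a set) \<Rightarrow> bool" where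
  "child_enumeration Fm J \<longleftrightarrow>
     (\<forall>n. \<forall>\<omega>\<in>alg_atoms (Fm n). bij_betw (J n \<omega>) UNIV (children Fm n \<omega>))"

section \<open>Martingales\<close>

text \<open>\<open>g\<close> is (a version of) the conditional expectation of \<open>f\<close> given \<open>N\<close>. The distribution's
  \<open>real_cond_exp\<close> is only available for real-valued \<open>f\<close>.\<close>

definition has_cond_exp ::
  "'a measure \<Rightarrow> 'a measure \<Rightarrow> ('a \<Rightarrow> 'b) \<Rightarrow> ('a \<Rightarrow> 'b::{banach, second_countable_topology}) \<Rightarrow> bool" where
  "has_cond_exp M N f g \<longleftrightarrow>
     integrable M f \<and> integrable M g \<and> g \<in> borel_measurable N \<and>
     (\<forall>A\<in>sets N. set_lebesgue_integral M A f = set_lebesgue_integral M A g)"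

definition martingale ::
  "'a measure \<Rightarrow> (nat \<Rightarrow> 'a measure) \<Rightarrow> (nat \<Rightarrow> 'a \<Rightarrow> 'b::{banach, second_countable_topology}) \<Rightarrow> bool" where
  "martingale M Fm F \<longleftrightarrow> (\<forall>n. has_cond_exp M (Fm n) (F (Suc n)) (F n))"

definition mart_L1_norm :: "'a measure \<Rightarrow> (nat \<Rightarrow> 'a \<Rightarrow> 'b::real_normed_vector) \<Rightarrow> ennreal" where
  "mart_L1_norm M F = (SUP n. \<integral>\<^sup>+x. ennreal (norm (F n x)) \<partial>M)"

text \<open>\<open>G\<close> is the sequence of conditional expectations of \<open>g\<close>. Measurability of \<open>g\<close> with respect to
  the limit \<open>\<sigma>\<close>-algebra makes \<open>g\<close> unique up to null sets, so that the norm of \<open>g\<close>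
  can serve as the norm of \<open>G\<close>.\<close>

definition represents ::
  "'a measure \<Rightarrow> (nat \<Rightarrow> 'a measure) \<Rightarrow> ('a \<Rightarrow> 'b) \<Rightarrow>
   (nat \<Rightarrow> 'a \<Rightarrow> 'b::{banach, second_countable_topology}) \<Rightarrow> bool" where
  "represents M Fm g G \<longleftrightarrow>
     g \<in> borel_measurable (limit_algebra M Fm) \<and> (\<forall>n. has_cond_exp M (Fm n) g (G n))"

definition riesz_potential ::
  "nat \<Rightarrow> real \<Rightarrow> (nat \<Rightarrow> 'a \<Rightarrow> 'b::real_vector) \<Rightarrow> nat \<Rightarrow> 'a \<Rightarrow> 'b" where
  "riesz_potential m \<alpha> F N x =
     (\<Sum>n=1..N. (real m powr (- \<alpha> * real n)) *\<^sub>R (F n x - F (n - 1) x))"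

section \<open>The space of martingales generated by \<open>W\<close>\<close>

text \<open>With \<open>'b = real\<close> this is \<open>V\<close>, with \<open>'b = real ^ 'l\<close> it is the \<open>l\<close>-th power of \<open>V\<close>,
  seen as tuples of vectors.\<close>

definition sum_zero :: "('b::comm_monoid_add ^ 'm::finite) set" where
  "sum_zero = {b. (\<Sum>j\<in>UNIV. b $ j) = 0}"

definition tensor :: "real ^ 'm \<Rightarrow> real ^ 'l \<Rightarrow> (real ^ 'l) ^ 'm" where
  "tensor v a = (\<chi> j. (v $ j) *\<^sub>R a)"

definition second_structural_condition :: "((real ^ 'l) ^ 'm) set \<Rightarrow> bool" where
  "second_structural_condition W \<longleftrightarrow>
     (\<forall>a. \<forall>v\<in>sum_zero.
        (\<exists>S c. card S = CARD('m) - 1 \<and> (\<forall>j\<in>S. v $ j = c)) \<and> tensor v a \<in> W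
          \<longrightarrow> tensor v a = 0)"

text \<open>The martingales with finite \<open>L\<^sub>1\<close> norm whose increments, restricted to each atom \<open>\<omega>\<close>, take
  the values \<open>b\<^sub>j\<close> on the children \<open>J n \<omega> j\<close>, for some \<open>b \<in> W\<close>.\<close>

definition W_space ::
  "'a measure \<Rightarrow> (nat \<Rightarrow> 'a measure) \<Rightarrow> (nat \<Rightarrow> 'a set \<Rightarrow> 'm \<Rightarrow> 'a set) \<Rightarrow>
   ((real ^ 'l) ^ 'm) set \<Rightarrow> (nat \<Rightarrow> 'a \<Rightarrow> real ^ 'l) set" where
  "W_space M Fm J W =
     {F. martingale M Fm F \<and> mart_L1_norm M F < \<infinity> \<and>
         (\<forall>n. \<forall>\<omega>\<in>alg_atoms (Fm n). \<exists>b\<in>W. \<forall>j. \<forall>x\<in>J n \<omega> j. F (Suc n) x - F n x = b $ j)}"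

section \<open>Lorentz spaces\<close>

definition decreasing_rearrangement ::
  "'a measure \<Rightarrow> ('a \<Rightarrow> 'b::real_normed_vector) \<Rightarrow> real \<Rightarrow> ennreal" where
  "decreasing_rearrangement M g t =
     (INF s\<in>{s. 0 \<le> s \<and> emeasure M {x\<in>space M. s < norm (g x)} \<le> ennreal t}. ennreal s)"

text \<open>The (quasi-)norm of \<open>L\<^bsub>p,1\<^esub>\<close>: the integral over \<open>(0, \<infinity>)\<close> of \<open>t\<^bsup>1/p\<^esup> g\<^sup>*(t)\<close> against \<open>dt / t\<close>.\<close>

definition lorentz1_norm :: "real \<Rightarrow> 'a measure \<Rightarrow> ('a \<Rightarrow> 'b::real_normed_vector) \<Rightarrow> ennreal" where
  "lorentz1_norm p M g =
     (\<integral>\<^sup>+t\<in>{0<..}. ennreal (t powr (1 / p) / t) * decreasing_rearrangement M g t \<partial>lborel)"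

definition lorentz1_space :: "real \<Rightarrow> 'a measure \<Rightarrow> ('a \<Rightarrow> 'b::real_normed_vector) set" where
  "lorentz1_space p M = {g \<in> borel_measurable M. lorentz1_norm p M g < \<infinity>}"

end

theory Submission
  imports Defs
begin

text \<open>
  Multiplying \<open>F\<^sub>n\<close> on an atom by its probability \<open>m\<^bsup>-n\<^esup>\<close> turns \<open>F\<close> into an additive vector-valued
  mass on atoms. The exponent \<open>\<alpha> = (p - 1) / p\<close> is the one for which \<open>m\<^bsup>-\<alpha>n\<^esup> \<parallel>F\<^sub>n\<parallel>\<close> has \<open>L\<^bsub>p,1\<^esub>\<close> norm
  at most a constant times the \<open>L\<^sub>1\<close> norm of \<open>F\<^sub>n\<close>. The potential is dominated by the sum of
  twice these functions, and a bound that is merely uniform in \<open>n\<close> does not sum. Indeed, for a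
  Dirac mass the potential behaves like \<open>r\<^bsup>-1/p\<^esup>\<close>, which is in weak \<open>L\<^sub>p\<close> only. The increments of
  a Dirac mass are spikes \<open>(m - 1, -1, \<dots>, -1) \<otimes> a\<close>, and the structural condition excludes them from \<open>W\<close>.

  By compactness it excludes approximate spikes too (\<open>second_structural_condition_spread\<close>): for
  some \<open>\<delta> > 0\<close> and every small \<open>\<epsilon> > 0\<close>, if passing from an atom to its children increases the \<open>L\<^sub>1\<close> norm of \<open>F\<close> on it by a factor of at most
  \<open>1 + \<epsilon>\<close>, then no child carries more than the fraction \<open>1 - \<delta>\<close> of the mass. Call an
  atom growing if the norm increases by more than that. The children of all the growing atoms
  together carry mass at most \<open>(1 + 1/\<epsilon>) \<parallel>F\<parallel>\<^sub>1\<close>, because the increase telescopes over \<open>n\<close>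
  (\<open>sum_mass_le\<close>).

  Now split \<open>\<parallel>F\<^sub>n\<parallel>\<close> according to the last level \<open>k \<le> n\<close> at which a point left a growing atom
  (\<open>k = 0\<close> if there is none). If \<open>E\<^sub>k\<close> is the mass that starts at level \<open>k\<close>, then after
  \<open>d = n - k\<close> further steps this part has \<open>L\<^sub>1\<close> norm at most \<open>(1 + \<epsilon>)\<^sup>d E\<^sub>k\<close> and supremum at
  most \<open>m\<^sup>n (1 - \<delta>)\<^sup>d E\<^sub>k\<close>. Interpolation between \<open>L\<^sub>1\<close> and \<open>L\<^sub>\<infinity>\<close>
  (\<open>lorentz1_norm_le_suminf\<close>) makes the powers of \<open>m\<close> cancel and charges it \<open>\<theta>\<^sup>d E\<^sub>k\<close>, where
  \<open>\<theta> = (1 + \<epsilon>)\<^bsup>1/p\<^esup> (1 - \<delta>)\<^bsup>\<alpha>\<^esup> < 1\<close> once \<open>\<epsilon>\<close> is small. The sum over \<open>d\<close> is geometric and the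
  sum over \<open>k\<close> is bounded by \<open>\<parallel>F\<parallel>\<^sub>1\<close>.
\<close>

section \<open>Interpolation in the Lorentz space\<close>

text \<open>
  Markov's inequality with a strict inequality in the level set, which covers the level \<open>R = 0\<close>.
\<close>

lemma emeasure_superlevel_le:
  assumes u: "u \<in> borel_measurable M" and int: "(\<integral>\<^sup>+x. u x \<partial>M) \<le> R * t" and "R < (\<infinity>::ennreal)"
  shows "emeasure M {x\<in>space M. R < u x} \<le> t"
proof (cases "R = 0")
  case True
  then have "(\<integral>\<^sup>+x. u x \<partial>M) = 0"
    using int by simp
  then have "emeasure M {x\<in>space M. u x \<noteq> 0} = 0"
    using u by (simp add: nn_integral_0_iff)
  moreover have "emeasure M {x\<in>space M. R < u x} \<le> emeasure M {x\<in>space M. u x \<noteq> 0}"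
    using u by (intro emeasure_mono) auto
  ultimately show ?thesis
    by simp
next
  case False
  have inv: "inverse R * R = 1"
    using False \<open>R < \<infinity>\<close>
    by (cases R) (auto simp: inverse_ennreal simp flip: ennreal_mult)
  have "emeasure M {x\<in>space M. R < u x} \<le> emeasure M {x\<in>space M. 1 \<le> inverse R * u x}"
  proof (rule emeasure_mono)
    have "1 \<le> inverse R * u x" if "R < u x" for x
      using mult_left_mono[of R "u x" "inverse R"] that inv by simp
    then show "{x\<in>space M. R < u x} \<subseteq> {x\<in>space M. 1 \<le> inverse R * u x}"
      by auto
  qed (use u in measurable)
  also have "\<dots> \<le> inverse R * (\<integral>\<^sup>+x. u x * indicator (space M) x \<partial>M)"
    using u by (intro nn_integral_Markov_inequality) auto
  also have "(\<integral>\<^sup>+x. u x * indicator (space M) x \<partial>M) = (\<integral>\<^sup>+x. u x \<partial>M)"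
    by (rule nn_integral_cong) simp
  also have "inverse R * \<dots> \<le> inverse R * (R * t)"
    using int by (rule mult_left_mono) simp
  also have "\<dots> = t"
    using inv by (simp flip: mult.assoc)
  finally show ?thesis .
qed

text \<open>
  Each \<open>h\<^sub>i\<close> may be treated either as bounded or as integrable, and for every \<open>t\<close> the cheaper option
  can be chosen for each \<open>i\<close> separately: the bounded ones add up to at most \<open>S\<close>, and the sum of the others exceeds
  its integral divided by \<open>t\<close> on a set of measure at most \<open>t\<close>.
\<close>

lemma decreasing_rearrangement_le_suminf:
  fixes g :: "'a \<Rightarrow> 'b::real_normed_vector" and h :: "nat \<Rightarrow> 'a \<Rightarrow> ennreal"
    and A B :: "nat \<Rightarrow> ennreal"
  assumes h: "\<And>i. h i \<in> borel_measurable M"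
    and dom: "\<And>x. x \<in> space M \<Longrightarrow> ennreal (norm (g x)) \<le> (\<Sum>i. h i x)"
    and A: "\<And>i. (\<integral>\<^sup>+x. h i x \<partial>M) \<le> A i"
    and B: "\<And>i x. x \<in> space M \<Longrightarrow> h i x \<le> B i"
    and t: "0 < t"
  shows "decreasing_rearrangement M g t \<le> (\<Sum>i. min (A i / ennreal t) (B i))"
proof (cases "(\<Sum>i. min (A i / ennreal t) (B i)) = \<infinity>")
  case False
  define small where "small i \<longleftrightarrow> B i \<le> A i / ennreal t" for i
  define S where "S = (\<Sum>i. if small i then B i else 0)"
  define R where "R = (\<Sum>i. if small i then 0 else A i / ennreal t)"
  define u where "u x = (\<Sum>i. if small i then 0 else h i x)" for x
  have split: "S + R = (\<Sum>i. min (A i / ennreal t) (B i))"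
    unfolding S_def R_def
    by (subst suminf_add[OF summableI summableI], rule suminf_cong) (auto simp: small_def min_def)
  then have fin: "S + R < \<infinity>"
    using False by (simp add: less_top)
  then have SR: "ennreal (enn2real (S + R)) = S + R"
    by simp
  have u_meas: "u \<in> borel_measurable M"
    unfolding u_def using h by measurable
  have "(\<integral>\<^sup>+x. u x \<partial>M) = (\<Sum>i. \<integral>\<^sup>+x. (if small i then 0 else h i x) \<partial>M)"
    unfolding u_def using h by (intro nn_integral_suminf) auto
  also have "\<dots> \<le> (\<Sum>i. (if small i then 0 else A i / ennreal t) * ennreal t)"
    using A t by (intro suminf_le summableI) (auto simp: ennreal_divide_times ennreal_times_divide
        simp flip: mult_divide_eq_ennreal divide_ennreal)
  also have "\<dots> = R * ennreal t"
    unfolding R_def by simp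
  finally have int: "(\<integral>\<^sup>+x. u x \<partial>M) \<le> R * ennreal t" .
  have sub: "ennreal (norm (g x)) \<le> S + u x" if "x \<in> space M" for x
  proof -
    have "ennreal (norm (g x)) \<le> (\<Sum>i. h i x)"
      by (rule dom[OF that])
    also have "\<dots> \<le> (\<Sum>i. (if small i then B i else 0) + (if small i then 0 else h i x))"
      using B[OF that] by (intro suminf_le summableI) auto
    also have "\<dots> = S + u x"
      unfolding S_def u_def by (rule suminf_add[OF summableI summableI, symmetric])
    finally show ?thesis .
  qed
  have "emeasure M {x\<in>space M. enn2real (S + R) < norm (g x)} \<le> emeasure M {x\<in>space M. R < u x}"
  proof (rule emeasure_mono)
    show "{x\<in>space M. enn2real (S + R) < norm (g x)} \<subseteq> {x\<in>space M. R < u x}"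
    proof safe
      fix x assume x: "x \<in> space M" "enn2real (S + R) < norm (g x)"
      then have "S + R < S + u x"
        using sub[OF x(1)] SR by (metis enn2real_nonneg ennreal_lessI less_le_trans order_le_less_trans)
      then show "R < u x"
        by (metis add_left_mono not_le)
    qed
  qed (use u_meas in measurable)
  also have "\<dots> \<le> ennreal t"
    by (rule emeasure_superlevel_le[OF u_meas int]) (use fin in \<open>simp add: less_top\<close>)
  finally have "decreasing_rearrangement M g t \<le> ennreal (enn2real (S + R))"
    unfolding decreasing_rearrangement_def by (intro INF_lower) auto
  then show ?thesis
    using SR split by simp
qed simp

text \<open>
  The minimum switches at \<open>t = A / B\<close>; the two ranges of \<open>t\<close> contribute multiples of the same power product.
\<close>

lemma nn_integral_lorentz_kernel:
  fixes p A B :: real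
  assumes p: "1 < p" and A: "0 \<le> A" and B: "0 \<le> B"
  shows "(\<integral>\<^sup>+t\<in>{0<..}. ennreal (t powr (1 / p) / t) * min (ennreal A / ennreal t) (ennreal B) \<partial>lborel)
    \<le> ennreal ((p + p / (p - 1)) * (A powr (1 / p) * B powr ((p - 1) / p)))" (is "?I \<le> _")
proof (cases "A = 0 \<or> B = 0")
  case True
  then have "?I = (\<integral>\<^sup>+t. 0 \<partial>(lborel :: real measure))"
    by (intro nn_integral_cong) (auto simp: min_def)
  then show ?thesis by simp
next
  case False
  then have A: "0 < A" and B: "0 < B" using assms by auto
  define T where "T = A / B"
  have T: "0 < T" using A B by (simp add: T_def)
  have low: "((\<lambda>t. t powr (1 / p - 1)) has_integral (T powr (1 / p - 1 + 1) / (1 / p - 1 + 1))) {0..T}"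
    using p T by (intro has_integral_powr_from_0) auto
  have high: "((\<lambda>t. t powr (1 / p - 2)) has_integral - (T powr (1 / p - 2 + 1)) / (1 / p - 2 + 1)) {T..}"
    using p T by (intro has_integral_powr_to_inf) (auto simp: field_simps)
  have "?I \<le> (\<integral>\<^sup>+t. ennreal B * (ennreal (t powr (1 / p - 1)) * indicator {0..T} t) +
      ennreal A * (ennreal (t powr (1 / p - 2)) * indicator {T..} t) \<partial>lborel)"
  proof (rule nn_integral_mono, cases)
    fix t :: real assume t: "0 < t"
    have 1: "t powr (1 / p) / t = t powr (1 / p - 1)"
      using t by (simp add: powr_diff)
    have 2: "t powr (1 / p) / t * (A / t) = A * t powr (1 / p - 2)"
      using t by (simp add: powr_diff power2_eq_square)
    show "ennreal (t powr (1 / p) / t) * min (ennreal A / ennreal t) (ennreal B) * indicator {0<..} t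
       \<le> ennreal B * (ennreal (t powr (1 / p - 1)) * indicator {0..T} t) +
         ennreal A * (ennreal (t powr (1 / p - 2)) * indicator {T..} t)"
    proof (cases "t \<le> T")
      case True
      have "ennreal (t powr (1 / p) / t) * min (ennreal A / ennreal t) (ennreal B)
          \<le> ennreal (t powr (1 / p) / t) * ennreal B"
        by (intro mult_left_mono) auto
      then show ?thesis
        using t True by (simp add: 1 mult.commute add_increasing2)
    next
      case False
      have "ennreal (t powr (1 / p) / t) * min (ennreal A / ennreal t) (ennreal B)
          \<le> ennreal (t powr (1 / p) / t) * (ennreal A / ennreal t)"
        by (intro mult_left_mono) auto
      also have "\<dots> = ennreal (t powr (1 / p) / t * (A / t))"
        using t A by (simp add: divide_ennreal flip: ennreal_mult)
      also have "\<dots> = ennreal A * ennreal (t powr (1 / p - 2))"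
        using A by (simp only: 2) (simp add: ennreal_mult)
      finally show ?thesis
        using t False by simp
    qed
  qed simp
  also have "\<dots> = ennreal B * ennreal (T powr (1 / p - 1 + 1) / (1 / p - 1 + 1)) +
      ennreal A * ennreal (- (T powr (1 / p - 2 + 1)) / (1 / p - 2 + 1))"
    using nn_integral_has_integral_lebesgue'[OF _ low] nn_integral_has_integral_lebesgue'[OF _ high]
    by (simp add: nn_integral_add nn_integral_cmult)
  also have "\<dots> = ennreal (B * (p * T powr (1 / p)) + A * ((p / (p - 1)) * T powr (1 / p - 1)))"
  proof -
    have "- (T powr (1 / p - 2 + 1)) / (1 / p - 2 + 1) = (p / (p - 1)) * T powr (1 / p - 1)"
      using p by (simp add: field_simps)
    moreover have "T powr (1 / p - 1 + 1) / (1 / p - 1 + 1) = p * T powr (1 / p)"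
      by simp
    ultimately show ?thesis
      using A B p by (simp only: ennreal_mult'[symmetric] ennreal_plus[symmetric] less_imp_le
          mult_nonneg_nonneg divide_nonneg_pos powr_ge_zero diff_gt_0_iff_gt order.trans[OF zero_le_one])
  qed
  also have "B * (p * T powr (1 / p)) + A * ((p / (p - 1)) * T powr (1 / p - 1))
      = (p + p / (p - 1)) * (A powr (1 / p) * B powr ((p - 1) / p))"
  proof -
    have q: "(p - 1) / p = 1 - 1 / p" using p by (simp add: field_simps)
    have "B * T powr (1 / p) = A powr (1 / p) * B powr ((p - 1) / p)"
      unfolding T_def q using A B by (simp add: powr_divide powr_diff)
    moreover have "A * T powr (1 / p - 1) = A powr (1 / p) * B powr ((p - 1) / p)"
      unfolding T_def q using A B by (simp add: powr_divide powr_diff)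
    moreover have "B * (p * T powr (1 / p)) + A * ((p / (p - 1)) * T powr (1 / p - 1))
        = p * (B * T powr (1 / p)) + (p / (p - 1)) * (A * T powr (1 / p - 1))"
      by simp
    ultimately show ?thesis by (simp only: distrib_right)
  qed
  finally show ?thesis .
qed

text \<open>
  The triangle inequality of \<open>L\<^bsub>p,1\<^esub>\<close> and its interpolation between \<open>L\<^sub>1\<close> and \<open>L\<^sub>\<infinity>\<close> in one
  step. Bounding the rearrangement of the whole sum pointwise in \<open>t\<close> avoids the failure of
  subadditivity of the rearrangement itself.
\<close>

lemma lorentz1_norm_le_suminf:
  fixes g :: "'a \<Rightarrow> 'b::real_normed_vector" and h :: "nat \<Rightarrow> 'a \<Rightarrow> ennreal"
    and A B :: "nat \<Rightarrow> real"
  assumes h: "\<And>i. h i \<in> borel_measurable M"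
    and dom: "\<And>x. x \<in> space M \<Longrightarrow> ennreal (norm (g x)) \<le> (\<Sum>i. h i x)"
    and A: "\<And>i. (\<integral>\<^sup>+x. h i x \<partial>M) \<le> ennreal (A i)" "\<And>i. 0 \<le> A i"
    and B: "\<And>i x. x \<in> space M \<Longrightarrow> h i x \<le> ennreal (B i)" "\<And>i. 0 \<le> B i"
    and p: "1 < p"
  shows "lorentz1_norm p M g
    \<le> (\<Sum>i. ennreal ((p + p / (p - 1)) * (A i powr (1 / p) * B i powr ((p - 1) / p))))"
proof -
  have "lorentz1_norm p M g \<le> (\<integral>\<^sup>+t. (\<Sum>i. ennreal (t powr (1 / p) / t) *
      min (ennreal (A i) / ennreal t) (ennreal (B i)) * indicator {0<..} t) \<partial>lborel)"
    unfolding lorentz1_norm_def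
  proof (rule nn_integral_mono, cases)
    fix t :: real assume t: "0 < t"
    have "decreasing_rearrangement M g t \<le> (\<Sum>i. min (ennreal (A i) / ennreal t) (ennreal (B i)))"
      by (rule decreasing_rearrangement_le_suminf[OF h dom A(1) B(1) t])
    from mult_left_mono[OF this, of "ennreal (t powr (1 / p) / t)"]
    show "ennreal (t powr (1 / p) / t) * decreasing_rearrangement M g t * indicator {0<..} t
      \<le> (\<Sum>i. ennreal (t powr (1 / p) / t) *
          min (ennreal (A i) / ennreal t) (ennreal (B i)) * indicator {0<..} t)"
      using t by (simp add: ennreal_suminf_cmult)
  qed simp
  also have "\<dots> = (\<Sum>i. \<integral>\<^sup>+t\<in>{0<..}. ennreal (t powr (1 / p) / t) *
      min (ennreal (A i) / ennreal t) (ennreal (B i)) \<partial>lborel)"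
    by (intro nn_integral_suminf) measurable
  also have "\<dots> \<le> (\<Sum>i. ennreal ((p + p / (p - 1)) * (A i powr (1 / p) * B i powr ((p - 1) / p))))"
    using nn_integral_lorentz_kernel[OF p A(2) B(2)] by (intro suminf_le summableI) auto
  finally show ?thesis .
qed


section \<open>Spreading forced by the structural condition\<close>

lemma continuous_on_tensor: "continuous_on S (tensor v)"
  unfolding tensor_def by (intro continuous_intros)

lemma sum_spike:
  "(\<Sum>j\<in>UNIV. if j = j0 then real (CARD('m)) - 1 else - 1) = 0" for j0 :: "'m::finite"
proof -
  have "(\<Sum>j\<in>UNIV. if j = j0 then real (CARD('m)) - 1 else - 1)
      = (\<Sum>j\<in>UNIV. (if j = j0 then real (CARD('m)) else 0) - 1)"
    by (rule sum.cong) auto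
  then show ?thesis
    by (simp add: sum_subtractf)
qed

text \<open>
  Normalised spikes form a compact set, which the condition makes disjoint from the closed set
  \<open>W\<close>; homogeneity then gives a distance proportional to \<open>\<parallel>a\<parallel>\<close>.
\<close>

lemma second_structural_condition_separated:
  fixes W :: "((real ^ 'l::finite) ^ 'm::finite) set"
  assumes W: "subspace W" "second_structural_condition W" and m: "2 \<le> CARD('m)"
  obtains \<eta> where "0 < \<eta>"
    "\<And>j0 a b. b \<in> W \<Longrightarrow> \<eta> * norm a \<le> norm (tensor (\<chi> j. if j = j0 then real (CARD('m)) - 1 else - 1) a - b)"
proof -
  define spike :: "'m \<Rightarrow> real ^ 'm" where
    "spike j0 = (\<chi> j. if j = j0 then real (CARD('m)) - 1 else - 1)" for j0
  define S where "S = (\<Union>j0. tensor (spike j0) ` sphere (0 :: real ^ 'l) 1)"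
  have "compact S"
    unfolding S_def by (intro compact_UN finite ballI compact_continuous_image continuous_on_tensor) auto
  moreover have "closed W"
    using W(1) by (rule closed_subspace)
  moreover have "S \<inter> W = {}"
  proof safe
    fix x assume "x \<in> S" "x \<in> W"
    then obtain j0 a where a: "norm a = 1" "tensor (spike j0) a \<in> W"
      by (auto simp: S_def)
    have "spike j0 \<in> sum_zero"
      by (simp add: sum_zero_def spike_def sum_spike)
    moreover have "card (- {j0}) = CARD('m) - 1 \<and> (\<forall>j\<in>- {j0}. spike j0 $ j = - 1)"
      by (simp add: Compl_eq_Diff_UNIV card_Diff_singleton spike_def)
    ultimately have zero: "tensor (spike j0) a = 0"
      using W(2) a(2) unfolding second_structural_condition_def by blast
    obtain j1 where "j1 \<noteq> j0"
      using m by (metis (full_types) One_nat_def UNIV_eq_I card.empty card_insert_disjoint empty_iff finite.emptyI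
          insert_iff not_less_eq_eq numeral_2_eq_2 order_refl)
    then have "tensor (spike j0) a $ j1 = - a"
      by (simp add: tensor_def spike_def)
    with zero a(1) show "x \<in> {}" by simp
  qed
  ultimately obtain \<eta> where \<eta>: "0 < \<eta>" "\<And>x y. x \<in> S \<Longrightarrow> y \<in> W \<Longrightarrow> \<eta> \<le> dist x y"
    using separate_compact_closed by metis
  have "\<eta> * norm a \<le> norm (tensor (spike j0) a - b)" if b: "b \<in> W" for j0 a b
  proof (cases "a = 0")
    case False
    let ?s = "inverse (norm a)"
    have "tensor (spike j0) (?s *\<^sub>R a) \<in> S"
      unfolding S_def using False by (intro UN_I[of j0] imageI) auto
    then have "\<eta> \<le> dist (tensor (spike j0) (?s *\<^sub>R a)) (?s *\<^sub>R b)"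
      using b W(1) by (intro \<eta>(2)) (auto simp: subspace_scale)
    also have "tensor (spike j0) (?s *\<^sub>R a) = ?s *\<^sub>R tensor (spike j0) a"
      by (simp add: tensor_def vec_eq_iff)
    also have "dist (?s *\<^sub>R tensor (spike j0) a) (?s *\<^sub>R b) = ?s * norm (tensor (spike j0) a - b)"
      by (simp add: dist_norm flip: scaleR_diff_right)
    finally show ?thesis
      using False by (simp add: field_simps)
  qed simp
  then show ?thesis
    using that \<eta>(1) unfolding spike_def by blast
qed

text \<open>
  If one child kept almost all of the mass while the total hardly grew, the other children
  would have almost none, so \<open>b\<close> would be close to the spike at that child.
\<close>

lemma second_structural_condition_spread:
  fixes W :: "((real ^ 'l::finite) ^ 'm::finite) set"
  assumes W: "subspace W" "W \<subseteq> sum_zero" "second_structural_condition W" and m: "2 \<le> CARD('m)"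
  obtains \<delta> where "0 < \<delta>" "\<delta> < 1"
    "\<And>a b j. b \<in> W \<Longrightarrow> (\<Sum>i\<in>UNIV. norm (a + b $ i)) \<le> (1 + \<delta>) * (real (CARD('m)) * norm a)
        \<Longrightarrow> norm (a + b $ j) \<le> (1 - \<delta>) * (real (CARD('m)) * norm a)"
proof -
  let ?m = "real (CARD('m))"
  obtain \<eta> where \<eta>: "0 < \<eta>"
    "\<And>j0 a b. b \<in> W \<Longrightarrow> \<eta> * norm a \<le> norm (tensor (\<chi> j. if j = j0 then ?m - 1 else - 1) a - b)"
    using second_structural_condition_separated[OF W(1,3) m] by metis
  \<comment> \<open>Below, the distance of \<open>b\<close> to a spike comes out less than \<open>4 \<delta> m \<parallel>a\<parallel>\<close>.\<close>
  define \<delta> where "\<delta> = min (1 / 2) (\<eta> / (8 * ?m))"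
  have \<delta>: "0 < \<delta>" "\<delta> < 1" "\<delta> * (8 * ?m) \<le> \<eta>"
    using \<eta>(1) m by (auto simp: \<delta>_def min_def field_simps)
  have "norm (a + b $ j) \<le> (1 - \<delta>) * (?m * norm a)"
    if b: "b \<in> W" and flat: "(\<Sum>i\<in>UNIV. norm (a + b $ i)) \<le> (1 + \<delta>) * (?m * norm a)" for a b j
  proof (rule ccontr)
    assume "\<not> ?thesis"
    then have big: "(1 - \<delta>) * (?m * norm a) < norm (a + b $ j)" by simp
    let ?r = "\<Sum>i\<in>- {j}. norm (a + b $ i)"
    have "(\<Sum>i\<in>UNIV. norm (a + b $ i)) = norm (a + b $ j) + ?r"
      by (subst sum.remove[of _ j]) (auto simp: Compl_eq_Diff_UNIV)
    then have rest: "?r < 2 * \<delta> * ?m * norm a"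
      using flat big by (simp add: algebra_simps)
    let ?x = "tensor (\<chi> i. if i = j then ?m - 1 else - 1) a - b"
    have off: "?x $ i = - (a + b $ i)" if "i \<noteq> j" for i
      using that by (simp add: tensor_def)
    have "(\<Sum>i\<in>UNIV. ?x $ i) = 0"
    proof -
      have "(\<Sum>i\<in>UNIV. b $ i) = 0"
        using b W(2) by (auto simp: sum_zero_def)
      moreover have "(\<Sum>i\<in>UNIV. (if i = j then ?m - 1 else - 1) *\<^sub>R a) = 0"
        by (simp add: sum_spike flip: scaleR_left.sum)
      ultimately show ?thesis
        by (simp add: tensor_def sum_subtractf)
    qed
    then have "?x $ j = - (\<Sum>i\<in>- {j}. ?x $ i)"
      by (subst (asm) sum.remove[of _ j]) (auto simp: Compl_eq_Diff_UNIV add_eq_0_iff2)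
    also have "\<dots> = (\<Sum>i\<in>- {j}. a + b $ i)"
      unfolding sum_negf[symmetric]
      by (rule sum.cong) (auto simp: tensor_def)
    finally have "norm (?x $ j) \<le> ?r"
      using norm_sum[of "\<lambda>i. a + b $ i" "- {j}"] by simp
    moreover have "(\<Sum>i\<in>- {j}. norm (?x $ i)) = ?r"
    proof (rule sum.cong)
      show "norm (?x $ i) = norm (a + b $ i)" if "i \<in> - {j}" for i
        using off[of i] that by (metis ComplD norm_minus_cancel singletonI)
    qed simp
    moreover have "norm ?x \<le> (\<Sum>i\<in>UNIV. norm (?x $ i))"
      by (subst norm_vec_def) (rule L2_set_le_sum, simp)
    moreover have "(\<Sum>i\<in>UNIV. norm (?x $ i)) = norm (?x $ j) + (\<Sum>i\<in>- {j}. norm (?x $ i))"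
      by (simp add: sum.remove[of _ j] Compl_eq_Diff_UNIV del: vector_minus_component)
    ultimately have "\<eta> * norm a < 4 * \<delta> * ?m * norm a"
      using \<eta>(2)[OF b, of a j] rest by linarith
    also have "\<dots> \<le> \<eta> * norm a"
    proof (rule mult_right_mono)
      have "4 * \<delta> * ?m \<le> \<delta> * (8 * ?m)" using \<delta>(1) by simp
      then show "4 * \<delta> * ?m \<le> \<eta>" using \<delta>(3) by linarith
    qed simp
    finally show False by simp
  qed
  then show ?thesis
    using that \<delta>(1,2) by blast
qed


section \<open>Atoms of a uniform filtration\<close>

locale uniform_filtered_prob_space = prob_space M
  for M :: "'a measure" +
  fixes Fm :: "nat \<Rightarrow> 'a measure" and m :: nat
  assumes uniform: "uniform_filtration m M Fm" and m_pos: "0 < m"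
begin

lemma space_Fm [simp]: "space (Fm n) = space M"
  and sets_Fm: "A \<in> sets (Fm n) \<Longrightarrow> A \<in> sets M"
  and finite_sets_Fm: "finite (sets (Fm n))"
  and sets_Fm_0: "sets (Fm 0) = {{}, space M}"
  using uniform by (auto simp: uniform_filtration_def subalgebra_def)

lemma sets_Fm_mono: "A \<in> sets (Fm n) \<Longrightarrow> n \<le> k \<Longrightarrow> A \<in> sets (Fm k)"
  using uniform filtration.sets_F_mono[of "space M" Fm n k] by (auto simp: uniform_filtration_def)

lemma measurable_Fm: "f \<in> borel_measurable (Fm n) \<Longrightarrow> f \<in> borel_measurable M"
  using uniform measurable_from_subalg[of M "Fm n"] by (auto simp: uniform_filtration_def)

lemma measurable_Fm_mono: "f \<in> borel_measurable (Fm n) \<Longrightarrow> n \<le> k \<Longrightarrow> f \<in> borel_measurable (Fm k)"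
  using sets_Fm_mono by (intro measurable_from_subalg[of "Fm k" "Fm n"]) (auto simp: subalgebra_def)

text \<open>
  As the algebra is finite, this intersection of measurable sets is again measurable.
\<close>

definition atom_at :: "nat \<Rightarrow> 'a \<Rightarrow> 'a set" where
  "atom_at n x = \<Inter>{A \<in> sets (Fm n). x \<in> A}"

lemma atom_at_subset: "A \<in> sets (Fm n) \<Longrightarrow> x \<in> A \<Longrightarrow> atom_at n x \<subseteq> A"
  by (auto simp: atom_at_def)

lemma mem_atom_at: "x \<in> atom_at n x"
  by (auto simp: atom_at_def)

lemma atom_at_sets:
  assumes x: "x \<in> space M"
  shows "atom_at n x \<in> sets (Fm n)"
proof -
  have "(\<Inter>A\<in>{A \<in> sets (Fm n). x \<in> A}. A) \<in> sets (Fm n)"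
    using x finite_sets_Fm sets.top[of "Fm n"] by (intro sets.finite_INT) auto
  then show ?thesis by (simp add: atom_at_def)
qed

lemma atom_at_atom:
  assumes x: "x \<in> space M"
  shows "atom_at n x \<in> alg_atoms (Fm n)"
proof -
  have "B = {} \<or> B = atom_at n x" if B: "B \<in> sets (Fm n)" "B \<subseteq> atom_at n x" for B
  proof (cases "x \<in> B")
    case True
    then show ?thesis using B atom_at_subset by blast
  next
    case False
    then have "atom_at n x \<subseteq> atom_at n x - B"
      using B(1) x by (intro atom_at_subset sets.Diff atom_at_sets) (auto simp: mem_atom_at)
    then show ?thesis using B(2) by blast
  qed
  then show ?thesis
    using atom_at_sets[OF x, of n] mem_atom_at[of x n] by (auto simp: alg_atoms_def)
qed

lemma atom_sets: "\<omega> \<in> alg_atoms (Fm n) \<Longrightarrow> \<omega> \<in> sets (Fm n)"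
  by (simp add: alg_atoms_def)

lemma atom_space: "\<omega> \<in> alg_atoms (Fm n) \<Longrightarrow> x \<in> \<omega> \<Longrightarrow> x \<in> space M"
  using sets.sets_into_space[OF atom_sets] by auto

lemma atom_subset:
  assumes "\<omega> \<in> alg_atoms (Fm n)" "x \<in> \<omega>" "A \<in> sets (Fm n)" "x \<in> A"
  shows "\<omega> \<subseteq> A"
proof -
  have "\<omega> \<inter> A \<in> sets (Fm n)"
    using assms atom_sets by auto
  then show ?thesis
    using assms by (auto simp: alg_atoms_def)
qed

lemma atom_eq_atom_at: "\<omega> \<in> alg_atoms (Fm n) \<Longrightarrow> x \<in> \<omega> \<Longrightarrow> \<omega> = atom_at n x"
  by (intro equalityI atom_subset[of \<omega> n x] atom_at_subset)
    (auto intro: atom_at_sets atom_space atom_sets mem_atom_at)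

lemma atoms_disjoint: "disjoint_family_on (\<lambda>\<omega>. \<omega>) (alg_atoms (Fm n))"
  unfolding disjoint_family_on_def using atom_eq_atom_at by blast

lemma finite_atoms: "finite (alg_atoms (Fm n))"
  using finite_sets_Fm[of n] by (rule finite_subset[rotated]) (auto simp: alg_atoms_def)

lemma sets_eq_Union_atoms:
  assumes A: "A \<in> sets (Fm n)"
  shows "A = (\<Union>\<omega>\<in>{\<omega> \<in> alg_atoms (Fm n). \<omega> \<subseteq> A}. \<omega>)"
proof -
  have "x \<in> (\<Union>\<omega>\<in>{\<omega> \<in> alg_atoms (Fm n). \<omega> \<subseteq> A}. \<omega>)" if "x \<in> A" for x
  proof -
    have "x \<in> space M" using sets.sets_into_space[OF A] that by auto
    then show ?thesis
      using atom_at_subset[OF A that] atom_at_atom mem_atom_at by blast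
  qed
  then show ?thesis by auto
qed

lemma atom_eq_Union_children:
  assumes \<omega>: "\<omega> \<in> alg_atoms (Fm n)"
  shows "\<omega> = (\<Union>\<omega>'\<in>children Fm n \<omega>. \<omega>')"
  unfolding children_def
  by (rule sets_eq_Union_atoms) (use sets_Fm_mono[OF atom_sets[OF \<omega>]] in simp)

lemma measure_atom: "\<omega> \<in> alg_atoms (Fm n) \<Longrightarrow> measure M \<omega> = 1 / real m ^ n"
proof (induction n arbitrary: \<omega>)
  case 0
  then have "\<omega> = space M"
    by (auto simp: alg_atoms_def sets_Fm_0)
  then show ?case by (simp add: prob_space)
next
  case (Suc n)
  obtain x where x: "x \<in> \<omega>"
    using Suc.prems by (auto simp: alg_atoms_def)
  define \<omega>0 where "\<omega>0 = atom_at n x"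
  have xs: "x \<in> space M"
    using x Suc.prems atom_space by auto
  have \<omega>0: "\<omega>0 \<in> alg_atoms (Fm n)"
    unfolding \<omega>0_def by (rule atom_at_atom[OF xs])
  have child: "\<omega> \<in> children Fm n \<omega>0"
    using Suc.prems x atom_subset[OF Suc.prems x sets_Fm_mono[OF atom_sets[OF \<omega>0], of "Suc n"]] mem_atom_at
    by (auto simp: children_def \<omega>0_def)
  have "measure M \<omega>0 = (\<Sum>\<omega>'\<in>children Fm n \<omega>0. measure M \<omega>')"
  proof (subst atom_eq_Union_children[OF \<omega>0], rule measure_finite_Union)
    show "finite (children Fm n \<omega>0)"
      using finite_atoms[of "Suc n"] by (simp add: children_def)
    show "(\<lambda>\<omega>. \<omega>) ` children Fm n \<omega>0 \<subseteq> sets M"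
      using sets_Fm atom_sets by (auto simp: children_def)
    show "disjoint_family_on (\<lambda>\<omega>. \<omega>) (children Fm n \<omega>0)"
      using atoms_disjoint[of "Suc n"] by (auto simp: children_def disjoint_family_on_def)
  qed simp
  also have "\<dots> = (\<Sum>\<omega>'\<in>children Fm n \<omega>0. measure M \<omega>)"
    using uniform \<omega>0 child unfolding uniform_filtration_def by (intro sum.cong refl) blast
  also have "\<dots> = real m * measure M \<omega>"
    using uniform \<omega>0 unfolding uniform_filtration_def by (metis sum_constant)
  finally show ?case
    using Suc.IH[OF \<omega>0] m_pos by (simp add: field_simps)
qed

text \<open>
  Inequalities between integrals are checked atom by atom: every set of a finite algebra is the
  disjoint union of its atoms.
\<close>

lemma set_integral_nonneg_of_atoms:
  fixes Z :: "'a \<Rightarrow> real"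
  assumes A: "A \<in> sets (Fm n)" and Z: "integrable M Z"
    and atoms: "\<And>\<omega>. \<omega> \<in> alg_atoms (Fm n) \<Longrightarrow> \<omega> \<subseteq> A \<Longrightarrow> 0 \<le> (LINT x:\<omega>|M. Z x)"
  shows "0 \<le> (LINT x:A|M. Z x)"
proof -
  let ?I = "{\<omega> \<in> alg_atoms (Fm n). \<omega> \<subseteq> A}"
  have "(LINT x:A|M. Z x) = (\<Sum>\<omega>\<in>?I. LINT x:\<omega>|M. Z x)"
  proof (subst sets_eq_Union_atoms[OF A], rule set_integral_finite_Union)
    show "finite ?I"
      using finite_atoms by simp
    show "disjoint_family_on (\<lambda>\<omega>. \<omega>) ?I"
      using atoms_disjoint by (auto simp: disjoint_family_on_def)
    show "\<omega> \<in> sets M" if "\<omega> \<in> ?I" for \<omega>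
      using that sets_Fm atom_sets by auto
    then show "set_integrable M \<omega> Z" if "\<omega> \<in> ?I" for \<omega>
      using that Z unfolding set_integrable_def by (intro integrable_mult_indicator) auto
  qed
  also have "\<dots> \<ge> 0"
    using atoms by (intro sum_nonneg) auto
  finally show ?thesis .
qed

lemma measurable_const_on_atom:
  fixes X :: "'a \<Rightarrow> 'b::real_normed_vector"
  assumes X: "X \<in> borel_measurable (Fm n)" and \<omega>: "\<omega> \<in> alg_atoms (Fm n)" and x: "x \<in> \<omega>" and y: "y \<in> \<omega>"
  shows "X y = X x"
proof -
  have "X -` {X x} \<inter> space (Fm n) \<in> sets (Fm n)"
    using X by (rule measurable_sets) simp
  from atom_subset[OF \<omega> x this] show ?thesis
    using x y atom_space[OF \<omega>] by auto
qed

text \<open>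
  A function that is measurable at level \<open>n\<close> is constant on an atom of probability \<open>m\<^bsup>-n\<^esup>\<close>, so its
  integral controls its values.
\<close>

lemma measurable_le_set_integral:
  fixes X :: "'a \<Rightarrow> real"
  assumes X: "X \<in> borel_measurable (Fm n)" "integrable M X" "\<And>x. 0 \<le> X x"
    and A: "A \<in> sets (Fm n)" and x: "x \<in> A"
  shows "X x \<le> real m ^ n * (LINT y:A|M. X y)"
proof -
  have xs: "x \<in> space M"
    using sets.sets_into_space[OF A] x by auto
  note \<omega> = atom_at_atom[OF xs, of n]
  have "X x / real m ^ n = (LINT y|M. indicator (atom_at n x) y *\<^sub>R X x)"
    using measure_atom[OF \<omega>] sets.Int_space_eq2[OF sets_Fm[OF atom_sets[OF \<omega>]]] sets_Fm[OF atom_sets[OF \<omega>]]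
    by (simp add: Int_commute)
  also have "\<dots> \<le> (LINT y:A|M. X y)"
    unfolding set_lebesgue_integral_def
  proof (rule integral_mono)
    show "integrable M (\<lambda>y. indicator (atom_at n x) y *\<^sub>R X x)"
      using sets_Fm[OF atom_sets[OF \<omega>]] by (simp add: emeasure_eq_measure)
    show "integrable M (\<lambda>y. indicator A y *\<^sub>R X y)"
      using sets_Fm[OF A] X(2) by (rule integrable_mult_indicator)
    show "indicator (atom_at n x) y *\<^sub>R X x \<le> indicator A y *\<^sub>R X y" for y
      using atom_at_subset[OF A x] measurable_const_on_atom[OF X(1) \<omega> mem_atom_at, of y] X(3)
      by (auto simp: indicator_def)
  qed
  finally show ?thesis
    using m_pos by (simp add: field_simps)
qed

lemma set_integral_children:
  fixes J :: "nat \<Rightarrow> 'a set \<Rightarrow> 'm::finite \<Rightarrow> 'a set" and Z :: "'a \<Rightarrow> real"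
  assumes J: "child_enumeration Fm J" and \<omega>: "\<omega> \<in> alg_atoms (Fm n)"
    and Z: "\<And>j x. x \<in> J n \<omega> j \<Longrightarrow> Z x = z j"
  shows "(LINT x:\<omega>|M. Z x) = (\<Sum>j\<in>UNIV. z j) / real m ^ Suc n"
proof -
  have bij: "bij_betw (J n \<omega>) UNIV (children Fm n \<omega>)"
    using J \<omega> by (simp add: child_enumeration_def)
  have child: "J n \<omega> j \<in> alg_atoms (Fm (Suc n))" for j
    using bij by (auto simp: bij_betw_def children_def)
  have meas: "J n \<omega> j \<in> sets M" for j
    using sets_Fm[OF atom_sets[OF child]] .
  have eq: "(\<lambda>x. indicator (J n \<omega> j) x *\<^sub>R Z x) = (\<lambda>x. indicator (J n \<omega> j) x *\<^sub>R z j)" for j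
    using Z by (auto simp: indicator_def)
  have "\<omega> = (\<Union>j\<in>UNIV. J n \<omega> j)"
    using atom_eq_Union_children[OF \<omega>] bij by (simp add: bij_betw_def)
  then have "(LINT x:\<omega>|M. Z x) = (LINT x:(\<Union>j\<in>UNIV. J n \<omega> j)|M. Z x)"
    by simp
  also have "\<dots> = (\<Sum>j\<in>UNIV. LINT x:J n \<omega> j|M. Z x)"
  proof (rule set_integral_finite_Union)
    show "disjoint_family_on (J n \<omega>) UNIV"
      unfolding disjoint_family_on_def
    proof safe
      fix i j :: 'm and x assume "i \<noteq> j" and x: "x \<in> J n \<omega> i" "x \<in> J n \<omega> j"
      then have "J n \<omega> i \<noteq> J n \<omega> j"
        using bij by (auto simp: bij_betw_def inj_on_def)
      then show "x \<in> {}"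
        using atom_eq_atom_at[OF child x(1)] atom_eq_atom_at[OF child x(2)] by simp
    qed
    show "set_integrable M (J n \<omega> j) Z" for j
      unfolding set_integrable_def eq using meas by (simp add: emeasure_eq_measure)
  qed (use meas in auto)
  also have "\<dots> = (\<Sum>j\<in>UNIV. z j / real m ^ Suc n)"
    unfolding set_lebesgue_integral_def eq using measure_atom[OF child] meas
    by (simp add: sets.Int_space_eq1)
  also have "\<dots> = (\<Sum>j\<in>UNIV. z j) / real m ^ Suc n"
    by (rule sum_divide_distrib[symmetric])
  finally show ?thesis .
qed

end


section \<open>Spreading processes\<close>

text \<open>
  The abstract situation to which the norms \<open>\<parallel>F\<^sub>n\<parallel>\<close> belong: the integral over an atom does not
  decrease when passing to its children, and if it hardly increases, then no child receives
  almost everything. Values of \<open>X\<close> are densities, so the whole mass of an atom concentrated on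
  one child would multiply its value by \<open>m\<close>.
\<close>

locale spreading_process = uniform_filtered_prob_space M Fm m
  for M :: "'a measure" and Fm m +
  fixes X :: "nat \<Rightarrow> 'a \<Rightarrow> real" and \<delta> \<epsilon> :: real
  assumes X_nonneg: "\<And>n x. 0 \<le> X n x"
    and X_meas: "\<And>n. X n \<in> borel_measurable (Fm n)"
    and X_int: "\<And>n. integrable M (X n)"
    and sub: "\<And>n \<omega>. \<omega> \<in> alg_atoms (Fm n) \<Longrightarrow> (LINT x:\<omega>|M. X n x) \<le> (LINT x:\<omega>|M. X (Suc n) x)"
    and spread: "\<And>n \<omega> x. \<omega> \<in> alg_atoms (Fm n) \<Longrightarrow> x \<in> \<omega> \<Longrightarrow>
      (LINT y:\<omega>|M. X (Suc n) y) \<le> (1 + \<epsilon>) * (LINT y:\<omega>|M. X n y) \<Longrightarrow>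
      X (Suc n) x \<le> (1 - \<delta>) * (real m * X n x)"
    and \<delta>: "0 < \<delta>" "\<delta> < 1" and \<epsilon>: "0 < \<epsilon>"
begin

definition growing :: "nat \<Rightarrow> 'a set" where
  "growing n = (\<Union>\<omega>\<in>{\<omega> \<in> alg_atoms (Fm n).
      (1 + \<epsilon>) * (LINT x:\<omega>|M. X n x) < (LINT x:\<omega>|M. X (Suc n) x)}. \<omega>)"

text \<open>
  A fresh start at level \<open>k\<close> happens on the children of growing atoms, which belong to level
  \<open>k - 1\<close>, and everywhere at level \<open>0\<close>.
\<close>

definition start :: "nat \<Rightarrow> 'a set" where
  "start k = (case k of 0 \<Rightarrow> space M | Suc i \<Rightarrow> growing i)"

definition alive :: "nat \<Rightarrow> nat \<Rightarrow> 'a set" where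
  "alive k d = start k - (\<Union>i\<in>{k..<k + d}. growing i)"

definition mass :: "nat \<Rightarrow> real" where
  "mass k = (LINT x:start k|M. X k x)"

lemma set_integrable_X: "A \<in> sets (Fm n) \<Longrightarrow> set_integrable M A (X k)"
  unfolding set_integrable_def using X_int sets_Fm by (intro integrable_mult_indicator)

lemma set_integral_lincomb:
  assumes "A \<in> sets (Fm n)"
  shows "(LINT x:A|M. a * X k x - b * X j x) = a * (LINT x:A|M. X k x) - b * (LINT x:A|M. X j x)"
  using set_integrable_X[OF assms] by (subst set_integral_diff) auto

lemma growing_sets: "growing n \<in> sets (Fm n)"
  unfolding growing_def using finite_atoms by (intro sets.finite_UN) (auto intro: atom_sets)

lemma atom_not_growing:
  assumes "\<omega> \<in> alg_atoms (Fm n)" "x \<in> \<omega>" "x \<notin> growing n"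
  shows "(LINT y:\<omega>|M. X (Suc n) y) \<le> (1 + \<epsilon>) * (LINT y:\<omega>|M. X n y)"
  using assms by (fastforce simp: growing_def not_less[symmetric])

lemma start_sets: "start k \<in> sets (Fm k)"
  using growing_sets sets_Fm_mono[of _ "k - 1" k] sets.top[of "Fm 0"]
  by (cases k) (auto simp: start_def)

lemma alive_Suc: "alive k (Suc d) = alive k d - growing (k + d)"
  by (auto simp: alive_def less_Suc_eq)

lemma alive_sets: "alive k d \<in> sets (Fm (k + d))"
proof (induction d)
  case 0
  then show ?case by (simp add: alive_def start_sets)
next
  case (Suc d)
  have "alive k (Suc d) \<in> sets (Fm (k + d))"
    unfolding alive_Suc using Suc growing_sets by auto
  then show ?case by (rule sets_Fm_mono) simp
qed

lemma mass_nonneg: "0 \<le> mass k"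
  unfolding mass_def set_lebesgue_integral_def using X_nonneg
  by (intro Bochner_Integration.integral_nonneg) simp

text \<open>
  No atom of level \<open>k + d\<close> inside \<open>alive k (Suc d)\<close> is growing, so each step costs a factor
  of at most \<open>1 + \<epsilon>\<close>.
\<close>

lemma alive_set_integral_le: "(LINT x:alive k d|M. X (k + d) x) \<le> (1 + \<epsilon>) ^ d * mass k"
proof (induction d)
  case 0
  then show ?case by (simp add: alive_def mass_def)
next
  case (Suc d)
  have A: "alive k (Suc d) \<in> sets (Fm (k + d))"
    unfolding alive_Suc using alive_sets growing_sets by auto
  have "0 \<le> (LINT x:alive k (Suc d)|M. (1 + \<epsilon>) * X (k + d) x - 1 * X (Suc (k + d)) x)"
  proof (rule set_integral_nonneg_of_atoms[OF A])
    fix \<omega> assume \<omega>: "\<omega> \<in> alg_atoms (Fm (k + d))" "\<omega> \<subseteq> alive k (Suc d)"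
    moreover obtain x where "x \<in> \<omega>"
      using \<omega>(1) by (auto simp: alg_atoms_def)
    ultimately show "0 \<le> (LINT x:\<omega>|M. (1 + \<epsilon>) * X (k + d) x - 1 * X (Suc (k + d)) x)"
      using atom_not_growing[OF \<omega>(1), of x] unfolding set_integral_lincomb[OF atom_sets[OF \<omega>(1)]]
      by (auto simp: alive_Suc)
  qed (use X_int in auto)
  then have "(LINT x:alive k (Suc d)|M. X (k + Suc d) x) \<le> (1 + \<epsilon>) * (LINT x:alive k (Suc d)|M. X (k + d) x)"
    unfolding set_integral_lincomb[OF A] by simp
  also have "(LINT x:alive k (Suc d)|M. X (k + d) x) \<le> (LINT x:alive k d|M. X (k + d) x)"
    unfolding set_lebesgue_integral_def
    using set_integrable_X[OF A] set_integrable_X[OF alive_sets] X_nonneg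
    by (intro integral_mono) (auto simp: set_integrable_def alive_Suc indicator_def)
  also note Suc
  finally show ?case
    using \<epsilon> by (simp add: mult_left_mono mult.assoc)
qed

text \<open>
  At the starting level the value is bounded through the total starting mass; afterwards the
  spreading hypothesis applies at every step.
\<close>

lemma alive_le: "x \<in> alive k d \<Longrightarrow> X (k + d) x \<le> real m ^ (k + d) * ((1 - \<delta>) ^ d * mass k)"
proof (induction d)
  case 0
  then show ?case
    using measurable_le_set_integral[OF X_meas X_int X_nonneg start_sets[of k], of x]
    by (simp add: alive_def mass_def)
next
  case (Suc d)
  then have x: "x \<in> alive k d" "x \<notin> growing (k + d)"
    by (auto simp: alive_Suc)
  have "x \<in> space M"
    using sets.sets_into_space[OF alive_sets[of k d]] x(1) by auto
  then have "X (k + Suc d) x \<le> (1 - \<delta>) * (real m * X (k + d) x)"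
    using spread[OF atom_at_atom mem_atom_at atom_not_growing[OF atom_at_atom mem_atom_at x(2)]] by simp
  also have "\<dots> \<le> (1 - \<delta>) * (real m * (real m ^ (k + d) * ((1 - \<delta>) ^ d * mass k)))"
    using Suc.IH[OF x(1)] \<delta> by (intro mult_left_mono) auto
  finally show ?case
    by (simp add: mult_ac)
qed

text \<open>
  On a growing atom the new mass is at most \<open>1 + 1/\<epsilon>\<close> times its increase, and the increase is
  nonnegative on all other atoms.
\<close>

lemma mass_Suc_le:
  "mass (Suc k) \<le> (1 + 1 / \<epsilon>) * ((\<integral>x. X (Suc k) x \<partial>M) - (\<integral>x. X k x \<partial>M))"
proof -
  let ?D = "\<lambda>x. 1 * X (Suc k) x - 1 * X k x"
  have "0 \<le> (LINT x:growing k|M. (1 / \<epsilon>) * X (Suc k) x - (1 + 1 / \<epsilon>) * X k x)"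
  proof (rule set_integral_nonneg_of_atoms[OF growing_sets])
    fix \<omega> assume \<omega>: "\<omega> \<in> alg_atoms (Fm k)" "\<omega> \<subseteq> growing k"
    moreover obtain x where x: "x \<in> \<omega>"
      using \<omega>(1) by (auto simp: alg_atoms_def)
    ultimately obtain \<omega>' where \<omega>': "\<omega>' \<in> alg_atoms (Fm k)" "x \<in> \<omega>'"
      "(1 + \<epsilon>) * (LINT x:\<omega>'|M. X k x) < (LINT x:\<omega>'|M. X (Suc k) x)"
      by (fastforce simp: growing_def)
    have "\<omega>' = \<omega>"
      using atom_eq_atom_at[OF \<omega>(1) x] atom_eq_atom_at[OF \<omega>'(1,2)] by simp
    then show "0 \<le> (LINT x:\<omega>|M. (1 / \<epsilon>) * X (Suc k) x - (1 + 1 / \<epsilon>) * X k x)"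
      using \<omega>'(3) \<epsilon> unfolding set_integral_lincomb[OF atom_sets[OF \<omega>(1)]]
      by (simp add: field_simps)
  qed (use X_int in auto)
  then have "mass (Suc k) \<le> (1 + 1 / \<epsilon>) * (LINT x:growing k|M. ?D x)"
    unfolding set_integral_lincomb[OF growing_sets] by (simp add: mass_def start_def algebra_simps)
  also have "(LINT x:growing k|M. ?D x) \<le> (\<integral>x. X (Suc k) x \<partial>M) - (\<integral>x. X k x \<partial>M)"
  proof -
    have "0 \<le> (LINT x:space M - growing k|M. ?D x)"
    proof (rule set_integral_nonneg_of_atoms)
      show "space M - growing k \<in> sets (Fm k)"
        using sets.compl_sets[OF growing_sets] by simp
      show "0 \<le> (LINT x:\<omega>|M. ?D x)" if "\<omega> \<in> alg_atoms (Fm k)" for \<omega>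
        using sub[OF that] unfolding set_integral_lincomb[OF atom_sets[OF that]] by simp
    qed (use X_int in auto)
    moreover have "(LINT x:space M - growing k|M. ?D x) = (\<integral>x. ?D x \<partial>M) - (LINT x:growing k|M. ?D x)"
    proof -
      have "(LINT x:space M - growing k|M. ?D x) = (\<integral>x. ?D x - indicator (growing k) x *\<^sub>R ?D x \<partial>M)"
        unfolding set_lebesgue_integral_def by (rule Bochner_Integration.integral_cong) (auto simp: indicator_def)
      also have "\<dots> = (\<integral>x. ?D x \<partial>M) - (LINT x:growing k|M. ?D x)"
        unfolding set_lebesgue_integral_def using X_int sets_Fm[OF growing_sets]
        by (intro Bochner_Integration.integral_diff integrable_mult_indicator) auto
      finally show ?thesis .
    qed
    ultimately show ?thesis
      using X_int by simp
  qed
  finally show ?thesis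
    using \<epsilon> by (simp add: mult_left_mono)
qed

lemma sum_mass_le: "(\<Sum>k\<le>n. mass k) \<le> (1 + 1 / \<epsilon>) * (\<integral>x. X n x \<partial>M)"
proof (induction n)
  case 0
  have "mass 0 = (\<integral>x. X 0 x \<partial>M)"
    unfolding mass_def start_def set_lebesgue_integral_def
    by (auto intro: Bochner_Integration.integral_cong)
  moreover have "0 \<le> (\<integral>x. X 0 x \<partial>M)"
    using X_nonneg by simp
  ultimately show ?case
    using \<epsilon> by (simp add: distrib_right)
next
  case (Suc n)
  then show ?case
    using mass_Suc_le[of n] by (simp add: right_diff_distrib)
qed

text \<open>
  The witness is the last level up to \<open>n\<close> reached from a growing atom, or \<open>0\<close>.
\<close>

lemma alive_cover:
  assumes x: "x \<in> space M"
  shows "\<exists>k\<le>n. x \<in> alive k (n - k)"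
proof (induction n)
  case 0
  then show ?case using x by (auto simp: alive_def start_def)
next
  case (Suc n)
  show ?case
  proof (cases "x \<in> growing n")
    case True
    then show ?thesis by (intro exI[of _ "Suc n"]) (auto simp: alive_def start_def)
  next
    case False
    from Suc obtain k where "k \<le> n" "x \<in> alive k (n - k)" by auto
    with False have "k \<le> Suc n" "x \<in> alive k (Suc n - k)"
      using alive_Suc[of k "n - k"] by (auto simp: Suc_diff_le)
    then show ?thesis by blast
  qed
qed

text \<open>
  The pieces are indexed by the starting level \<open>k\<close> and the age \<open>d\<close>. At every point each
  \<open>X n\<close> is one of these pieces, and different \<open>n\<close> use different pairs \<open>(k, d)\<close>.
\<close>

lemma lorentz1_norm_le:
  fixes g :: "'a \<Rightarrow> 'b::real_normed_vector"
  assumes p: "1 < p" and \<theta>: "(1 + \<epsilon>) powr (1 / p) * (1 - \<delta>) powr ((p - 1) / p) < 1" (is "?\<theta> < 1")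
    and L: "\<And>n. (\<integral>x. X n x \<partial>M) \<le> L"
    and dom: "\<And>x. x \<in> space M \<Longrightarrow>
      ennreal (norm (g x)) \<le> (\<Sum>n. ennreal (real m powr (- ((p - 1) / p) * real n) * X n x))"
  shows "lorentz1_norm p M g \<le> ennreal ((p + p / (p - 1)) * (1 + 1 / \<epsilon>) / (1 - ?\<theta>) * L)"
proof -
  define \<alpha> where "\<alpha> = (p - 1) / p"
  have \<alpha>: "1 / p = 1 - \<alpha>"
    using p by (simp add: \<alpha>_def field_simps)
  define w where "w n = real m powr (- \<alpha> * real n)" for n
  define h where "h k d x = ennreal (w (k + d) * (indicator (alive k d) x * X (k + d) x))" for k d x
  define A where "A k d = w (k + d) * ((1 + \<epsilon>) ^ d * mass k)" for k d
  define B where "B k d = w (k + d) * (real m ^ (k + d) * ((1 - \<delta>) ^ d * mass k))" for k d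
  define c where "c = p + p / (p - 1)"
  have c: "0 \<le> c" using p by (simp add: c_def)
  have w: "0 < w n" for n
    using m_pos by (simp add: w_def)
  have alive_M: "alive k d \<in> sets M" for k d
    using sets_Fm[OF alive_sets] .
  have h_meas: "h k d \<in> borel_measurable M" for k d
    using measurable_Fm[OF X_meas] alive_M unfolding h_def by measurable
  have A_bound: "(\<integral>\<^sup>+x. h k d x \<partial>M) \<le> ennreal (A k d)" for k d
  proof -
    have int: "integrable M (\<lambda>x. indicator (alive k d) x * X (k + d) x)"
      using set_integrable_X[OF alive_sets] by (simp add: set_integrable_def)
    then have "(\<integral>\<^sup>+x. h k d x \<partial>M) = ennreal (\<integral>x. w (k + d) * (indicator (alive k d) x * X (k + d) x) \<partial>M)"
      unfolding h_def using w X_nonneg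
      by (intro nn_integral_eq_integral) (auto simp: less_imp_le)
    also have "\<dots> = ennreal (w (k + d) * (LINT x:alive k d|M. X (k + d) x))"
      by (simp add: set_lebesgue_integral_def)
    also have "\<dots> \<le> ennreal (A k d)"
      unfolding A_def using alive_set_integral_le w by (intro ennreal_leI mult_left_mono) (auto simp: less_imp_le)
    finally show ?thesis .
  qed
  have A_nonneg: "0 \<le> A k d" for k d
    using w mass_nonneg \<epsilon> by (simp add: A_def less_imp_le)
  have B_nonneg: "0 \<le> B k d" for k d
    using w mass_nonneg \<delta> by (simp add: B_def less_imp_le)
  have B_bound: "h k d x \<le> ennreal (B k d)" for k d x
  proof (cases "x \<in> alive k d")
    case True
    then show ?thesis
      unfolding h_def B_def using alive_le[OF True] w
      by (intro ennreal_leI mult_left_mono) (auto simp: less_imp_le)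
  qed (simp add: h_def)
  have product: "A k d powr (1 / p) * B k d powr ((p - 1) / p) = mass k * ?\<theta> ^ d" for k d
  proof (cases "mass k = 0")
    case False
    then have mass: "0 < mass k" using mass_nonneg[of k] by simp
    \<comment> \<open>This cancellation of the powers of \<open>m\<close> is where the order of the potential has to match \<open>p\<close>.\<close>
    have "w n powr (1 - \<alpha>) * (w n * real m ^ n) powr \<alpha> = 1" for n
      using m_pos unfolding w_def
      by (simp add: powr_powr powr_mult powr_add[symmetric] powr_realpow[symmetric] algebra_simps)
    note w_cancel = this[of "k + d"]
    have pow: "(x ^ d) powr \<beta> = (x powr \<beta>) ^ d" if "0 < x" for x \<beta> :: real
      using that by (simp add: powr_realpow[symmetric] powr_powr mult.commute)
    have "A k d powr (1 - \<alpha>) * B k d powr \<alpha>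
        = (w (k + d) powr (1 - \<alpha>) * (w (k + d) * real m ^ (k + d)) powr \<alpha>)
          * (((1 + \<epsilon>) ^ d) powr (1 - \<alpha>) * ((1 - \<delta>) ^ d) powr \<alpha>)
          * (mass k powr (1 - \<alpha>) * mass k powr \<alpha>)"
      using w[of "k + d"] \<epsilon> \<delta> mass by (simp add: A_def B_def powr_mult mult_ac)
    also have "mass k powr (1 - \<alpha>) * mass k powr \<alpha> = mass k"
      using mass by (simp add: powr_add[symmetric])
    also have "((1 + \<epsilon>) ^ d) powr (1 - \<alpha>) * ((1 - \<delta>) ^ d) powr \<alpha> = ?\<theta> ^ d"
      using \<epsilon> \<delta> by (simp add: pow power_mult_distrib \<alpha> flip: \<alpha>_def)
    finally show ?thesis
      unfolding w_cancel \<alpha> \<alpha>_def[symmetric] by simp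
  qed (simp add: A_def B_def)
  define H where "H = (\<lambda>i. case prod_decode i of (k, d) \<Rightarrow> h k d)"
  define a where "a = (\<lambda>i. case prod_decode i of (k, d) \<Rightarrow> A k d)"
  define b where "b = (\<lambda>i. case prod_decode i of (k, d) \<Rightarrow> B k d)"
  have "lorentz1_norm p M g
    \<le> (\<Sum>i. ennreal (c * (a i powr (1 / p) * b i powr ((p - 1) / p))))"
    unfolding c_def
  proof (rule lorentz1_norm_le_suminf[where h = H])
    fix x assume x: "x \<in> space M"
    obtain s where s: "\<And>n. s n \<le> n" "\<And>n. x \<in> alive (s n) (n - s n)"
      using alive_cover[OF x] by metis
    define \<phi> where "\<phi> n = prod_encode (s n, n - s n)" for n
    have H_\<phi>: "H (\<phi> n) x = ennreal (w n * X n x)" for n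
      using s[of n] by (simp add: H_def \<phi>_def h_def)
    have "inj \<phi>"
    proof (rule injI)
      fix i j assume "\<phi> i = \<phi> j"
      then have "s i = s j" "i - s i = j - s j"
        by (auto simp: \<phi>_def prod_encode_eq)
      then show "i = j"
        using s(1)[of i] s(1)[of j] by linarith
    qed
    have "(\<Sum>n. ennreal (w n * X n x)) \<le> (\<Sum>i. H i x)"
    proof (rule suminf_le_const[OF summableI])
      fix N
      have "(\<Sum>n<N. ennreal (w n * X n x)) = (\<Sum>i\<in>\<phi> ` {..<N}. H i x)"
        using \<open>inj \<phi>\<close> by (subst sum.reindex) (auto simp: H_\<phi> inj_on_def)
      also have "\<dots> \<le> (\<Sum>i. H i x)"
        by (intro sum_le_suminf summableI) auto
      finally show "(\<Sum>n<N. ennreal (w n * X n x)) \<le> (\<Sum>i. H i x)" .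
    qed
    then show "ennreal (norm (g x)) \<le> (\<Sum>i. H i x)"
      using dom[OF x] unfolding w_def \<alpha>_def by (rule order_trans[rotated])
  qed (use h_meas A_bound B_bound A_nonneg B_nonneg p in \<open>auto simp: H_def a_def b_def split: prod.splits\<close>)
  also have "\<dots> = (\<Sum>i. (\<lambda>(k, d). ennreal (c * (mass k * ?\<theta> ^ d))) (prod_decode i))"
    by (rule suminf_cong) (auto simp: a_def b_def product split: prod.splits)
  also have "\<dots> = (\<Sum>k. \<Sum>d. ennreal (c * (mass k * ?\<theta> ^ d)))"
    by (rule suminf_ennreal_2dimen) simp
  also have "\<dots> = (\<Sum>k. ennreal (c * mass k / (1 - ?\<theta>)))"
  proof (rule suminf_cong)
    fix k
    have "(\<lambda>d. c * mass k * ?\<theta> ^ d) sums (c * mass k * (1 / (1 - ?\<theta>)))"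
      using \<theta> by (intro sums_mult geometric_sums) simp
    then show "(\<Sum>d. ennreal (c * (mass k * ?\<theta> ^ d))) = ennreal (c * mass k / (1 - ?\<theta>))"
      using c mass_nonneg by (intro suminf_ennreal_eq) (auto simp: mult.assoc)
  qed
  also have "\<dots> \<le> ennreal (c * (1 + 1 / \<epsilon>) / (1 - ?\<theta>) * L)"
  proof (rule suminf_le_const[OF summableI])
    fix N
    have "(\<Sum>k<N. mass k) \<le> (\<Sum>k\<le>N. mass k)"
      using mass_nonneg by (intro sum_mono2) auto
    also have "\<dots> \<le> (1 + 1 / \<epsilon>) * (\<integral>x. X N x \<partial>M)"
      by (rule sum_mass_le)
    also have "\<dots> \<le> (1 + 1 / \<epsilon>) * L"
      using L \<epsilon> by (intro mult_left_mono) auto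
    finally have "c / (1 - ?\<theta>) * (\<Sum>k<N. mass k) \<le> c / (1 - ?\<theta>) * ((1 + 1 / \<epsilon>) * L)"
      using c \<theta> by (intro mult_left_mono) auto
    moreover have "(\<Sum>k<N. ennreal (c * mass k / (1 - ?\<theta>))) = ennreal (c / (1 - ?\<theta>) * (\<Sum>k<N. mass k))"
      using c \<theta> mass_nonneg by (subst sum_ennreal) (auto simp: sum_distrib_left)
    ultimately show "(\<Sum>k<N. ennreal (c * mass k / (1 - ?\<theta>))) \<le> ennreal (c * (1 + 1 / \<epsilon>) / (1 - ?\<theta>) * L)"
      by (simp add: ennreal_leI mult.assoc)
  qed
  finally show ?thesis
    by (simp add: c_def)
qed

end


section \<open>The Riesz potential of a bounded martingale\<close>

context uniform_filtered_prob_space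
begin

lemma martingaleD:
  assumes "martingale M Fm F"
  shows "integrable M (F n)" "F n \<in> borel_measurable (Fm n)"
    "A \<in> sets (Fm n) \<Longrightarrow> (LINT x:A|M. F (Suc n) x) = (LINT x:A|M. F n x)"
  using assms by (auto simp: martingale_def has_cond_exp_def)

lemma Union_sets_Fm_subset: "(\<Union>n. sets (Fm n)) \<subseteq> Pow (space M)"
proof (rule UN_least)
  show "sets (Fm n) \<subseteq> Pow (space M)" for n
    using sets.space_closed[of "Fm n"] by simp
qed

lemma sets_limit_algebra: "A \<in> sets (Fm n) \<Longrightarrow> A \<in> sets (limit_algebra M Fm)"
  unfolding limit_algebra_def by (rule in_measure_of[OF Union_sets_Fm_subset]) blast

lemma space_limit_algebra: "space (limit_algebra M Fm) = space M"
  by (simp add: limit_algebra_def space_measure_of_conv)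

lemma subalgebra_limit_algebra: "subalgebra M (limit_algebra M Fm)"
proof -
  have "sets (limit_algebra M Fm) \<subseteq> sets M"
    unfolding limit_algebra_def sets_measure_of[OF Union_sets_Fm_subset]
    by (rule sets.sigma_sets_subset) (use sets_Fm in blast)
  then show ?thesis
    by (simp add: subalgebra_def space_limit_algebra)
qed

lemma borel_measurable_limit_algebra:
  assumes "f \<in> borel_measurable (Fm n)"
  shows "f \<in> borel_measurable (limit_algebra M Fm)"
proof -
  have "subalgebra (limit_algebra M Fm) (Fm n)"
    using sets_limit_algebra by (auto simp: subalgebra_def space_limit_algebra)
  then show ?thesis
    using assms by (rule measurable_from_subalg)
qed

lemma riesz_potential_eq_sum:
  "riesz_potential m \<alpha> F N x
    = (\<Sum>i<N. (real m powr (- \<alpha> * real (Suc i))) *\<^sub>R (F (Suc i) x - F i x))"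
  unfolding riesz_potential_def One_nat_def sum.atLeast1_atMost_eq by simp

text \<open>
  The increments are bounded in \<open>L\<^sub>1\<close> and the weights decay geometrically, so the series
  converges absolutely in \<open>L\<^sub>1\<close>. Integrating it over a set of level \<open>n\<close> kills all increments from
  level \<open>n\<close> on, which leaves the partial sum.
\<close>

lemma represents_riesz_potential:
  fixes F :: "nat \<Rightarrow> 'a \<Rightarrow> 'b::{banach, second_countable_topology}"
  assumes F: "martingale M Fm F" and L: "\<And>n. (\<integral>x. norm (F n x) \<partial>M) \<le> L"
    and \<alpha>: "0 < \<alpha>" and m: "2 \<le> m"
  shows "represents M Fm (\<lambda>x. \<Sum>i. (real m powr (- \<alpha> * real (Suc i))) *\<^sub>R (F (Suc i) x - F i x))
    (riesz_potential m \<alpha> F)"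
proof -
  define f where "f = (\<lambda>i x. (real m powr (- \<alpha> * real (Suc i))) *\<^sub>R (F (Suc i) x - F i x))"
  define g where "g = (\<lambda>x. \<Sum>i. f i x)"
  note F_int = martingaleD(1)[OF F] and F_meas = martingaleD(2)[OF F]
  have f_int: "integrable M (f i)" for i
    unfolding f_def using F_int by auto
  have f_meas: "f i \<in> borel_measurable (Fm n)" if "i < n" for i n
    unfolding f_def using that
    by (intro borel_measurable_scaleR borel_measurable_diff borel_measurable_const
        measurable_Fm_mono[OF F_meas]) auto
  have f_norm: "(\<integral>x. norm (f i x) \<partial>M) \<le> (real m powr (- \<alpha>)) ^ Suc i * (2 * L)" for i
  proof -
    have "(\<integral>x. norm (f i x) \<partial>M) = real m powr (- \<alpha> * real (Suc i)) * (\<integral>x. norm (F (Suc i) x - F i x) \<partial>M)"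
      unfolding f_def by simp
    also have "(\<integral>x. norm (F (Suc i) x - F i x) \<partial>M) \<le> (\<integral>x. norm (F (Suc i) x) + norm (F i x) \<partial>M)"
      using F_int by (intro integral_mono norm_triangle_ineq4) auto
    also have "\<dots> \<le> 2 * L"
      using F_int L[of i] L[of "Suc i"] by simp
    also have "real m powr (- \<alpha> * real (Suc i)) = (real m powr (- \<alpha>)) ^ Suc i"
      using m by (simp only: powr_powr[symmetric]) (rule powr_realpow, simp)
    finally show ?thesis
      by (simp add: mult_left_mono)
  qed
  have summable_norm: "summable (\<lambda>i. \<integral>x. norm (f i x) \<partial>M)"
  proof (rule summable_comparison_test')
    have "real m powr (- \<alpha>) < 1"
      using m \<alpha> powr_less_mono[of "- \<alpha>" 0 "real m"] by simp
    then show "summable (\<lambda>i. (real m powr (- \<alpha>)) ^ Suc i * (2 * L))"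
      by (intro summable_mult2) (simp add: summable_geometric)
    show "norm (\<integral>x. norm (f i x) \<partial>M) \<le> (real m powr (- \<alpha>)) ^ Suc i * (2 * L)" for i
      using f_norm by simp
  qed
  have AE_summable: "AE x in M. summable (\<lambda>i. norm (f i x))"
  proof -
    have "(\<integral>\<^sup>+x. (\<Sum>i. ennreal (norm (f i x))) \<partial>M) = (\<Sum>i. \<integral>\<^sup>+x. ennreal (norm (f i x)) \<partial>M)"
      using f_int by (intro nn_integral_suminf) auto
    also have "\<dots> = (\<Sum>i. ennreal (\<integral>x. norm (f i x) \<partial>M))"
      using f_int by (intro suminf_cong nn_integral_eq_integral) auto
    also have "\<dots> \<noteq> \<infinity>"
      using summable_norm by (simp add: ennreal_suminf_neq_top)
    finally have "AE x in M. (\<Sum>i. ennreal (norm (f i x))) \<noteq> \<infinity>"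
      using f_int by (intro nn_integral_PInf_AE) auto
    then show ?thesis
      by eventually_elim (rule summable_suminf_not_top, auto)
  qed
  have G_eq: "riesz_potential m \<alpha> F n = (\<lambda>x. \<Sum>i<n. f i x)" for n
    by (rule ext) (simp add: riesz_potential_eq_sum f_def)
  have "has_cond_exp M (Fm n) g (riesz_potential m \<alpha> F n)" for n
    unfolding has_cond_exp_def
  proof (intro conjI ballI)
    show "integrable M g"
      unfolding g_def using f_int AE_summable summable_norm by (rule integrable_suminf)
    show "integrable M (riesz_potential m \<alpha> F n)"
      unfolding G_eq using f_int by auto
    show "riesz_potential m \<alpha> F n \<in> borel_measurable (Fm n)"
      unfolding G_eq using f_meas by (intro borel_measurable_sum) auto
  next
    fix A assume A: "A \<in> sets (Fm n)"
    define fA where "fA = (\<lambda>i x. indicator A x *\<^sub>R f i x)"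
    have fA_int: "integrable M (fA i)" for i
      unfolding fA_def using sets_Fm[OF A] f_int by (rule integrable_mult_indicator)
    have fA_norm: "norm (fA i x) \<le> norm (f i x)" for i x
      by (simp add: fA_def indicator_def)
    have tail: "integral\<^sup>L M (fA i) = 0" if "n \<le> i" for i
    proof -
      have Ai: "A \<in> sets (Fm i)"
        using A that by (rule sets_Fm_mono)
      have F_set: "set_integrable M A (F j)" for j
        unfolding set_integrable_def using sets_Fm[OF A] F_int by (rule integrable_mult_indicator)
      have "integral\<^sup>L M (fA i) = (LINT x:A|M. (real m powr (- \<alpha> * real (Suc i))) *\<^sub>R (F (Suc i) x - F i x))"
        by (simp only: fA_def f_def set_lebesgue_integral_def)
      also have "\<dots> = (real m powr (- \<alpha> * real (Suc i))) *\<^sub>R (LINT x:A|M. F (Suc i) x - F i x)"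
        by (rule set_integral_scaleR_right)
      also have "\<dots> = 0"
        using martingaleD(3)[OF F Ai] set_integral_diff[OF F_set F_set, of "Suc i" i] by simp
      finally show ?thesis .
    qed
    have "(LINT x:A|M. g x) = (\<integral>x. (\<Sum>i. fA i x) \<partial>M)"
      unfolding set_lebesgue_integral_def g_def fA_def
      by (rule Bochner_Integration.integral_cong) (auto simp: indicator_def)
    also have "\<dots> = (\<Sum>i. integral\<^sup>L M (fA i))"
    proof (rule integral_suminf[OF fA_int])
      show "AE x in M. summable (\<lambda>i. norm (fA i x))"
        using AE_summable
        by eventually_elim (rule summable_comparison_test', assumption, use fA_norm in auto)
      show "summable (\<lambda>i. \<integral>x. norm (fA i x) \<partial>M)"
        using summable_norm
      proof (rule summable_comparison_test')
        show "norm (\<integral>x. norm (fA i x) \<partial>M) \<le> (\<integral>x. norm (f i x) \<partial>M)" for i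
          using fA_int f_int fA_norm by (simp add: integral_mono)
      qed
    qed
    also have "\<dots> = (\<Sum>i<n. integral\<^sup>L M (fA i))"
      using tail by (intro suminf_finite) auto
    also have "\<dots> = (\<integral>x. (\<Sum>i<n. fA i x) \<partial>M)"
      by (rule Bochner_Integration.integral_sum[symmetric]) (rule fA_int)
    also have "\<dots> = (LINT x:A|M. riesz_potential m \<alpha> F n x)"
      by (simp only: set_lebesgue_integral_def G_eq scaleR_sum_right fA_def)
    finally show "(LINT x:A|M. g x) = (LINT x:A|M. riesz_potential m \<alpha> F n x)" .
  qed
  moreover have "g \<in> borel_measurable (limit_algebra M Fm)"
    unfolding g_def using borel_measurable_limit_algebra[OF f_meas[OF lessI]]
    by (intro borel_measurable_suminf)
  ultimately show ?thesis
    unfolding represents_def g_def f_def by blast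
qed

text \<open>
  The weights decrease, so each \<open>F\<^sub>n\<close> enters two increments, both with weight at most
  \<open>m\<^bsup>-\<alpha>n\<^esup>\<close>. Where the series does not converge absolutely, the right-hand side is infinite.
\<close>

lemma norm_riesz_series_le:
  fixes F :: "nat \<Rightarrow> 'a \<Rightarrow> 'b::banach"
  assumes \<alpha>: "0 \<le> \<alpha>"
  shows "ennreal (norm (\<Sum>i. (real m powr (- \<alpha> * real (Suc i))) *\<^sub>R (F (Suc i) x - F i x)))
    \<le> (\<Sum>n. ennreal (real m powr (- \<alpha> * real n) * (2 * norm (F n x))))" (is "ennreal (norm (\<Sum>i. ?f i)) \<le> _")
proof -
  define a where "a n = ennreal (real m powr (- \<alpha> * real n) * norm (F n x))" for n
  have "ennreal (norm (\<Sum>i. ?f i)) \<le> (\<Sum>i. ennreal (norm (?f i)))"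
  proof (cases "summable (\<lambda>i. norm (?f i))")
    case True
    then have "norm (\<Sum>i. ?f i) \<le> (\<Sum>i. norm (?f i))"
      by (rule summable_norm)
    then show ?thesis
      unfolding suminf_ennreal2[OF norm_ge_zero True] by (rule ennreal_leI)
  next
    case False
    then have "(\<Sum>i. ennreal (norm (?f i))) = top"
      using summable_suminf_not_top[of "\<lambda>i. norm (?f i)", OF norm_ge_zero] by blast
    then show ?thesis by simp
  qed
  also have "\<dots> \<le> (\<Sum>i. a (Suc i) + a i)"
  proof (intro suminf_le summableI)
    fix i
    let ?c = "real m powr (- \<alpha> * real (Suc i))"
    have c: "?c \<le> real m powr (- \<alpha> * real i)"
      using m_pos \<alpha> by (intro powr_mono) (auto simp: mult_left_mono)
    have "norm (?f i) \<le> ?c * (norm (F (Suc i) x) + norm (F i x))"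
      using norm_triangle_ineq4[of "F (Suc i) x" "F i x"] by (simp add: mult_left_mono)
    also have "\<dots> \<le> ?c * norm (F (Suc i) x) + real m powr (- \<alpha> * real i) * norm (F i x)"
      unfolding distrib_left using mult_right_mono[OF c norm_ge_zero] by (rule add_left_mono)
    finally have "ennreal (norm (?f i))
        \<le> ennreal (?c * norm (F (Suc i) x) + real m powr (- \<alpha> * real i) * norm (F i x))"
      by (rule ennreal_leI)
    also have "\<dots> = a (Suc i) + a i"
      unfolding a_def by (rule ennreal_plus) simp_all
    finally show "ennreal (norm (?f i)) \<le> a (Suc i) + a i" .
  qed
  also have "\<dots> = (\<Sum>i. a (Suc i)) + (\<Sum>i. a i)"
    by (rule suminf_add[symmetric]) auto
  also have "\<dots> \<le> (\<Sum>i. a i) + (\<Sum>i. a i)"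
  proof (rule add_right_mono, rule suminf_le_const[OF summableI])
    fix n
    have "(\<Sum>i<n. a (Suc i)) \<le> (\<Sum>i<Suc n. a i)"
      unfolding sum.lessThan_Suc_shift by (simp add: add_increasing)
    also have "\<dots> \<le> (\<Sum>i. a i)"
      by (intro sum_le_suminf summableI) auto
    finally show "(\<Sum>i<n. a (Suc i)) \<le> (\<Sum>i. a i)" .
  qed
  also have "\<dots> = (\<Sum>n. ennreal (real m powr (- \<alpha> * real n) * (2 * norm (F n x))))"
    unfolding a_def by (subst suminf_add) (auto simp flip: ennreal_plus intro!: suminf_cong)
  finally show ?thesis .
qed

lemma mart_L1_norm_ge:
  assumes "martingale M Fm F" "mart_L1_norm M F < \<infinity>"
  shows "(\<integral>x. norm (F n x) \<partial>M) \<le> enn2real (mart_L1_norm M F)"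
proof -
  have "ennreal (\<integral>x. norm (F n x) \<partial>M) = (\<integral>\<^sup>+x. ennreal (norm (F n x)) \<partial>M)"
    using martingaleD(1)[OF assms(1)] by (intro nn_integral_eq_integral[symmetric]) auto
  also have "\<dots> \<le> mart_L1_norm M F"
    unfolding mart_L1_norm_def by (rule SUP_upper) simp
  also have "\<dots> = ennreal (enn2real (mart_L1_norm M F))"
    using assms(2) by simp
  finally show ?thesis
    by (simp add: ennreal_le_iff)
qed

end


section \<open>Martingales generated by a space without spikes\<close>

context uniform_filtered_prob_space
begin

lemma W_space_children:
  fixes J :: "nat \<Rightarrow> 'a set \<Rightarrow> 'm::finite \<Rightarrow> 'a set" and W :: "((real ^ 'l::finite) ^ 'm) set"
  assumes J: "child_enumeration Fm J" and F: "F \<in> W_space M Fm J W" and \<omega>: "\<omega> \<in> alg_atoms (Fm n)"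
  obtains a b where "b \<in> W" "\<And>x. x \<in> \<omega> \<Longrightarrow> F n x = a"
    "\<And>j x. x \<in> J n \<omega> j \<Longrightarrow> F n x = a \<and> F (Suc n) x = a + b $ j"
    "\<And>x. x \<in> \<omega> \<Longrightarrow> \<exists>j. x \<in> J n \<omega> j"
proof -
  have mart: "martingale M Fm F"
    using F by (simp add: W_space_def)
  obtain x0 where x0: "x0 \<in> \<omega>"
    using \<omega> by (auto simp: alg_atoms_def)
  obtain b where b: "b \<in> W" "\<And>j x. x \<in> J n \<omega> j \<Longrightarrow> F (Suc n) x - F n x = b $ j"
    using F \<omega> unfolding W_space_def by blast
  have const: "F n x = F n x0" if "x \<in> \<omega>" for x
    using martingaleD(2)[OF mart] \<omega> x0 that by (rule measurable_const_on_atom)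
  have "bij_betw (J n \<omega>) UNIV (children Fm n \<omega>)"
    using J \<omega> by (simp add: child_enumeration_def)
  then have cover: "\<omega> = (\<Union>j. J n \<omega> j)"
    using atom_eq_Union_children[OF \<omega>] by (simp add: bij_betw_def)
  show ?thesis
  proof (rule that[OF b(1) const])
    fix j x assume x: "x \<in> J n \<omega> j"
    then have "x \<in> \<omega>" using cover by blast
    then show "F n x = F n x0 \<and> F (Suc n) x = F n x0 + b $ j"
      using const b(2)[OF x] by (metis add.commute diff_add_cancel)
  qed (use cover in auto)
qed

text \<open>
  The geometric property of \<open>W\<close> transfers to martingales because integrals over an atom are
  averages over its children. The factor 2 prepares for \<open>\<parallel>F\<^sub>n\<^sub>+\<^sub>1 - F\<^sub>n\<parallel> \<le> \<parallel>F\<^sub>n\<^sub>+\<^sub>1\<parallel> + \<parallel>F\<^sub>n\<parallel>\<close> in the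
  estimate of the potential.
\<close>

lemma W_space_spreading:
  fixes J :: "nat \<Rightarrow> 'a set \<Rightarrow> 'm::finite \<Rightarrow> 'a set" and W :: "((real ^ 'l::finite) ^ 'm) set"
  assumes m: "m = CARD('m)" and J: "child_enumeration Fm J" and W: "W \<subseteq> sum_zero"
    and F: "F \<in> W_space M Fm J W"
    and flat: "\<And>a b j. b \<in> W \<Longrightarrow> (\<Sum>i\<in>UNIV. norm (a + b $ i)) \<le> (1 + \<epsilon>) * (real m * norm a)
        \<Longrightarrow> norm (a + b $ j) \<le> (1 - \<delta>) * (real m * norm a)"
    and pos: "0 < \<delta>" "\<delta> < 1" "0 < \<epsilon>"
  shows "spreading_process M Fm m (\<lambda>n x. 2 * norm (F n x)) \<delta> \<epsilon>"
proof -
  have mart: "martingale M Fm F"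
    using F by (simp add: W_space_def)
  have step: "\<exists>a b. b \<in> W \<and> (\<forall>x\<in>\<omega>. F n x = a \<and> (\<exists>j. F (Suc n) x = a + b $ j)) \<and>
      (LINT x:\<omega>|M. 2 * norm (F n x)) = 2 * (real m * norm a) / real m ^ Suc n \<and>
      (LINT x:\<omega>|M. 2 * norm (F (Suc n) x)) = 2 * (\<Sum>j\<in>UNIV. norm (a + b $ j)) / real m ^ Suc n"
    if \<omega>: "\<omega> \<in> alg_atoms (Fm n)" for \<omega> n
  proof -
    obtain a b where ab: "b \<in> W" "\<And>x. x \<in> \<omega> \<Longrightarrow> F n x = a"
      "\<And>j x. x \<in> J n \<omega> j \<Longrightarrow> F n x = a \<and> F (Suc n) x = a + b $ j"
      "\<And>x. x \<in> \<omega> \<Longrightarrow> \<exists>j. x \<in> J n \<omega> j"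
      by (rule W_space_children[OF J F \<omega>]) (rule that)
    have "(LINT x:\<omega>|M. 2 * norm (F n x)) = (\<Sum>j\<in>(UNIV :: 'm set). 2 * norm a) / real m ^ Suc n"
      by (rule set_integral_children[OF J \<omega>]) (use ab(3) in simp)
    moreover have "(LINT x:\<omega>|M. 2 * norm (F (Suc n) x)) = (\<Sum>j\<in>UNIV. 2 * norm (a + b $ j)) / real m ^ Suc n"
      by (rule set_integral_children[OF J \<omega>]) (use ab(3) in simp)
    ultimately show ?thesis
      using ab m by (intro exI[of _ a] exI[of _ b]) (auto simp: sum_distrib_left, meson)
  qed
  show ?thesis
  proof unfold_locales
    fix n \<omega> assume \<omega>: "\<omega> \<in> alg_atoms (Fm n)"
    obtain a b where ab: "b \<in> W" "\<And>x. x \<in> \<omega> \<Longrightarrow> F n x = a" "\<And>x. x \<in> \<omega> \<Longrightarrow> \<exists>j. F (Suc n) x = a + b $ j"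
      "(LINT x:\<omega>|M. 2 * norm (F n x)) = 2 * (real m * norm a) / real m ^ Suc n"
      "(LINT x:\<omega>|M. 2 * norm (F (Suc n) x)) = 2 * (\<Sum>j\<in>UNIV. norm (a + b $ j)) / real m ^ Suc n"
      using step[OF \<omega>] by blast
    have "(\<Sum>j\<in>UNIV. b $ j) = 0"
      using ab(1) W by (auto simp: sum_zero_def)
    then have "real m *\<^sub>R a = (\<Sum>j\<in>UNIV. a + b $ j)"
      using m by (simp add: sum.distrib scaleR_conv_of_real sum_constant_scaleR)
    then have "real m * norm a \<le> (\<Sum>j\<in>UNIV. norm (a + b $ j))"
      using norm_sum[of "\<lambda>j. a + b $ j" UNIV] norm_scaleR[of "real m" a] by simp
    then show "(LINT x:\<omega>|M. 2 * norm (F n x)) \<le> (LINT x:\<omega>|M. 2 * norm (F (Suc n) x))"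
      unfolding ab(4,5) by (intro divide_right_mono) auto
    fix x assume x: "x \<in> \<omega>"
      and le: "(LINT y:\<omega>|M. 2 * norm (F (Suc n) y)) \<le> (1 + \<epsilon>) * (LINT y:\<omega>|M. 2 * norm (F n y))"
    have "(\<Sum>j\<in>UNIV. norm (a + b $ j)) \<le> (1 + \<epsilon>) * (real m * norm a)"
      using le m_pos unfolding ab(4,5) times_divide_eq_right divide_le_cancel by simp
    moreover obtain j where "F (Suc n) x = a + b $ j"
      using ab(3)[OF x] by blast
    ultimately show "2 * norm (F (Suc n) x) \<le> (1 - \<delta>) * (real m * (2 * norm (F n x)))"
      using flat[OF ab(1), of a j] ab(2)[OF x] by simp
  qed (use martingaleD[OF mart] pos in auto)
qed

end

text \<open>
  The factor is the \<open>p\<close>-th root of \<open>(1 + \<epsilon>) q\<close> with \<open>q = (1 - \<delta>)\<^bsup>p-1\<^esup> < 1\<close>, so it suffices that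
  \<open>1 + \<epsilon>\<close> does not exceed the midpoint of \<open>1\<close> and \<open>1 / q\<close>.
\<close>

lemma contraction_factor:
  fixes p \<delta> :: real
  assumes p: "1 < p" and \<delta>: "0 < \<delta>" "\<delta> < 1"
  obtains \<epsilon> where "0 < \<epsilon>" "\<epsilon> \<le> \<delta>" "(1 + \<epsilon>) powr (1 / p) * (1 - \<delta>) powr ((p - 1) / p) < 1"
proof -
  define q where "q = (1 - \<delta>) powr (p - 1)"
  have q: "0 < q" "q < 1"
    using p \<delta> powr_less_mono2[of "p - 1" "1 - \<delta>" 1] by (auto simp: q_def)
  define \<epsilon> where "\<epsilon> = min \<delta> ((1 / q - 1) / 2)"
  have \<epsilon>: "0 < \<epsilon>" "\<epsilon> \<le> \<delta>"
    using \<delta> q by (auto simp: \<epsilon>_def)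
  have "\<epsilon> \<le> (1 / q - 1) / 2"
    unfolding \<epsilon>_def by (rule min.cobounded2)
  then have "(1 + \<epsilon>) * q \<le> (1 + (1 / q - 1) / 2) * q"
    using q by (intro mult_right_mono) auto
  also have "\<dots> < 1"
    using q by (simp add: field_simps)
  finally have "((1 + \<epsilon>) * q) powr (1 / p) < 1"
    using \<epsilon> q p powr_less_mono2[of "1 / p" "(1 + \<epsilon>) * q" 1] by simp
  then have "(1 + \<epsilon>) powr (1 / p) * (1 - \<delta>) powr ((p - 1) / p) < 1"
    using \<epsilon> q by (simp add: powr_mult q_def powr_powr)
  then show ?thesis
    using that \<epsilon> by blast
qed


section \<open>Boundedness of the Riesz potential\<close>

theorem theorem1p9:
  fixes M :: "'a measure"
    and Fm :: "nat \<Rightarrow> 'a measure"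
    and J :: "nat \<Rightarrow> 'a set \<Rightarrow> 'm::finite \<Rightarrow> 'a set"
    and W :: "((real ^ 'l::finite) ^ 'm) set"
    and p :: real
  assumes "prob_space M"
    and "CARD('m) \<ge> 3"
    and "uniform_filtration (CARD('m)) M Fm"
    and "child_enumeration Fm J"
    and "subspace W" and "W \<subseteq> sum_zero"
    and "second_structural_condition W"
    and "1 < p"
  shows "\<exists>C::real. 0 \<le> C \<and>
    (\<forall>F\<in>W_space M Fm J W.
       \<exists>g. represents M Fm g (riesz_potential (CARD('m)) ((p - 1) / p) F) \<and>
           g \<in> lorentz1_space p M \<and>
           lorentz1_norm p M g \<le> ennreal C * mart_L1_norm M F)"
proof -
  interpret uniform_filtered_prob_space M Fm "CARD('m)"
    using assms(1,3) by (auto simp: uniform_filtered_prob_space_def uniform_filtered_prob_space_axioms_def)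
  obtain \<delta> where \<delta>: "0 < \<delta>" "\<delta> < 1"
    "\<And>a b j. b \<in> W \<Longrightarrow> (\<Sum>i\<in>UNIV. norm (a + b $ i)) \<le> (1 + \<delta>) * (real (CARD('m)) * norm a)
        \<Longrightarrow> norm (a + b $ j) \<le> (1 - \<delta>) * (real (CARD('m)) * norm a)"
    using second_structural_condition_spread[OF assms(5,6,7)] assms(2) by auto
  obtain \<epsilon> where \<epsilon>: "0 < \<epsilon>" "\<epsilon> \<le> \<delta>" "(1 + \<epsilon>) powr (1 / p) * (1 - \<delta>) powr ((p - 1) / p) < 1" (is "?\<theta> < 1")
    using contraction_factor[OF \<open>1 < p\<close> \<delta>(1,2)] .
  define C where "C = (p + p / (p - 1)) * (1 + 1 / \<epsilon>) / (1 - ?\<theta>) * 2"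
  have C: "0 \<le> C"
    using \<epsilon> \<open>1 < p\<close> by (simp add: C_def)
  have flat: "norm (a + b $ j) \<le> (1 - \<delta>) * (real (CARD('m)) * norm a)"
    if "b \<in> W" "(\<Sum>i\<in>UNIV. norm (a + b $ i)) \<le> (1 + \<epsilon>) * (real (CARD('m)) * norm a)" for a b j
  proof -
    have "(1 + \<epsilon>) * (real (CARD('m)) * norm a) \<le> (1 + \<delta>) * (real (CARD('m)) * norm a)"
      using \<epsilon>(2) by (intro mult_right_mono) auto
    with that show ?thesis using \<delta>(3) by (meson order_trans)
  qed
  show ?thesis
  proof (intro exI[of _ C] conjI ballI C)
    fix F assume F: "F \<in> W_space M Fm J W"
    then have mart: "martingale M Fm F" and fin: "mart_L1_norm M F < \<infinity>"
      by (auto simp: W_space_def)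
    define L where "L = enn2real (mart_L1_norm M F)"
    have L: "(\<integral>x. norm (F n x) \<partial>M) \<le> L" for n
      unfolding L_def by (rule mart_L1_norm_ge[OF mart fin])
    interpret X: spreading_process M Fm "CARD('m)" "\<lambda>n x. 2 * norm (F n x)" \<delta> \<epsilon>
      by (rule W_space_spreading[OF refl assms(4,6) F flat \<delta>(1,2) \<epsilon>(1)])
    define g where "g x = (\<Sum>i. (real (CARD('m)) powr (- ((p - 1) / p) * real (Suc i))) *\<^sub>R (F (Suc i) x - F i x))" for x
    have rep: "represents M Fm g (riesz_potential (CARD('m)) ((p - 1) / p) F)"
      unfolding g_def[abs_def] using assms(2,8) by (intro represents_riesz_potential[OF mart L]) auto
    have "lorentz1_norm p M g \<le> ennreal ((p + p / (p - 1)) * (1 + 1 / \<epsilon>) / (1 - ?\<theta>) * (2 * L))"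
    proof (rule X.lorentz1_norm_le[OF \<open>1 < p\<close> \<epsilon>(3)])
      show "(\<integral>x. 2 * norm (F n x) \<partial>M) \<le> 2 * L" for n
        using L by simp
      show "ennreal (norm (g x)) \<le> (\<Sum>n. ennreal (real (CARD('m)) powr (- ((p - 1) / p) * real n) * (2 * norm (F n x))))" for x
        unfolding g_def using \<open>1 < p\<close> by (intro norm_riesz_series_le) simp
    qed
    also have "\<dots> = ennreal (C * L)"
      by (simp only: C_def mult.assoc)
    also have "\<dots> = ennreal C * mart_L1_norm M F"
      using C fin by (simp add: L_def ennreal_mult)
    finally have norm: "lorentz1_norm p M g \<le> ennreal C * mart_L1_norm M F" .
    moreover have "ennreal C * mart_L1_norm M F < \<infinity>"
      using fin by (simp add: ennreal_mult_less_top)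
    moreover have "g \<in> borel_measurable M"
      using rep measurable_from_subalg[OF subalgebra_limit_algebra] by (auto simp: represents_def)
    ultimately have "g \<in> lorentz1_space p M"
      by (simp add: lorentz1_space_def)
    then show "\<exists>g. represents M Fm g (riesz_potential (CARD('m)) ((p - 1) / p) F) \<and>
        g \<in> lorentz1_space p M \<and> lorentz1_norm p M g \<le> ennreal C * mart_L1_norm M F"
      using rep norm by blast
  qed
qed

end
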